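(* Let $f\in L^2(\Omega)$, $J\ge 1$, $v_J\in V_J$ arbitrary, $u_J\in V_J$ the Galerkin solution, and let $\mathbf r_j,\mathbf D_j$ ($j=1,\dots,J$), $\mathbf r_0$, $\mathbf A_0$ be as defined in the context. Let $\mathbf c_0=\mathbf A_0^{-1}\mathbf r_0$ and let $\mathbf c_0^{(m)}$, $m=0,1,\dots$, be the iterates of the preconditioned conjugate gradient method applied to $\mathbf A_0\mathbf c_0=\mathbf r_0$ with zero initial guess. For an iteration index $i$ put $$\mu_i^2=\sum_{m=0}^{i-1}\|\mathbf c_0^{(m+1)}-\mathbf c_0^{(m)}\|_{\mathbf A_0}^2 ,$$ and let $\zeta_i^2$ be any upper bound on the squared error, i.e. $\|\mathbf c_0-\mathbf c_0^{(i)}\|_{\mathbf A_0}^2\le \zeta_i^2$. Then $$\mathbf r_0^*\mathbf A_0^{-1}\mathbf r_0\le \mu_i^2+\zeta_i^2$$ and $$\|\nabla(u_J-v_J)\|\le C_S^{1/2}\,\overline C_B^{1/2}\Big(\sum_{j=1}^J\mathbf r_j^*\mathbf D_j^{-1}\mathbf r_j+\mu_i^2+\zeta_i^2\Big)^{1/2}.$$ Moreover, let $\theta>0$ and suppose that the iteration index $i$ satisfies the stopping criterion $$\zeta_i^2\le\theta\Big(\sum_{j=1}^J\mathbf r_j^*\mathbf D_j^{-1}\mathbf r_j+\mu_i^2\Big).$$ Then $$\Big(\sum_{j=1}^J\mathbf r_j^*\mathbf D_j^{-1}\mathbf r_j+\mu_i^2+\zeta_i^2\Big)^{1/2}\le(1+\theta)^{1/2}\,c_S^{-1/2}\,\overline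 c_B^{-1/2}\,\|\nabla(u_J-v_J)\| .$$ Here $c_S,C_S,\overline c_B,\overline C_B$ are the constants from the context; they depend only on $d$ and the shape-regularity constant $\gamma_0$ of $\mathcal T_0$ (in particular, not on $J$ nor on the size of the coarsest-level problem).
   Context: $\Omega\subset\mathbb R^d$, $d\in\{2,3\}$, is an open bounded polytope with Lipschitz-continuous boundary; $\|\cdot\|$ is the $L^2(\Omega)$-norm. $\mathcal T_0$ is a matching simplicial mesh of $\Omega$ (the intersection of two distinct elements is empty or a common vertex, edge or face), and $\mathcal T_1,\mathcal T_2,\dots$ are obtained by successive uniform dyadic refinement (each simplex is split into $2^d$ simplices). $h_j\in L^\infty(\Omega)$ is the piecewise constant mesh-size function, $h_j|_K=h_K=\operatorname{diam}K$ for $K\in\mathcal T_j$; it satisfies $h_j=2^{-j}h_0$. The shape-regularity constant $\gamma_j$ is the smallest number with $h_K/\rho_K\le\gamma_j$ for all $K\in\mathcal T_j$, $\rho_K$ being the diameter of the largest ball inscribed in $K$; $\gamma_j=\gamma_0$ for $d=2$ and $\gamma_j\le C_{3D}\gamma_0$ with a fixed constant $C_{3D}$ for $d=3$. $V_j$ is the space of continuous functions that are affine on each element of $\mathcal T_j$ and vanish on $\partial\Omega$; $\phi^{(j)}_1,\dots,\phi^{(j)}_{\#\mathcal K_j}$ is its basis of hat functions associated with the $\#\mathcal K_j$ nodes of $\mathcal T_j$ not on $\partial\Omega$. The Galerkin solution $u_J\in V_J$ is defined by $\int_\Omega\nabla u_J\cdot\nabla w_J=\int_\Omega f w_J$ for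 all $w_J\in V_J$. The residual of $v_J$ is $\langle r,w\rangle=\int_\Omega fw-\nabla v_J\cdot\nabla w$, $w\in H^1_0(\Omega)$. The residual vectors are $\mathbf r_j\in\mathbb R^{\#\mathcal K_j}$, $[\mathbf r_j]_m=\langle r,\phi^{(j)}_m\rangle$, $j=0,\dots,J$. $\mathbf D_j$ is the diagonal matrix with $[\mathbf D_j]_{m,m}=\int_\Omega\nabla\phi_m^{(j)}\cdot\nabla\phi_m^{(j)}$. $\mathbf A_0$ is the coarsest-level stiffness matrix $[\mathbf A_0]_{mn}=\int_\Omega\nabla\phi^{(0)}_n\cdot\nabla\phi^{(0)}_m$, $\|\mathbf v\|_{\mathbf A_0}^2=\mathbf v^*\mathbf A_0\mathbf v$, and $*$ denotes transposition. The preconditioned conjugate gradient method uses a symmetric positive definite preconditioner $\mathbf P$ and exact arithmetic: $\mathbf c_0^{(m)}$ minimizes $\|\mathbf c_0-\mathbf y\|_{\mathbf A_0}$ over $\mathbf y\in\operatorname{span}\{(\mathbf P^{-1}\mathbf A_0)^k\mathbf P^{-1}\mathbf r_0:\ 0\le k<m\}$, $\mathbf c_0^{(0)}=0$. Constants: $c_S,C_S>0$, depending only on $d$ and $\gamma_0$, are such that for every $J\ge0$ and every $w_J\in V_J$ $$c_S\|\nabla w_J\|^2\le\inf_{w_j\in V_j;\ w_J=\sum_{j=0}^Jw_j}\Big(\|\nabla w_0\|^2+\sum_{j=1}^J\|h_j^{-1}w_j\|^2\Big)\le C_S\|\nabla w_J\|^2 .$$ $c_B,C_B>0$, depending only on $d$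 and $\gamma_0$, are such that for all $j\ge 0$ and all $w_j=\sum_i w_{j,i}\in V_j$ with $w_{j,i}\in\operatorname{span}\{\phi_i^{(j)}\}$: $c_B\|h_j^{-1}w_j\|^2\le\sum_i\|\nabla w_{j,i}\|^2\le C_B\|h_j^{-1}w_j\|^2$. Further, $\overline c_B=\min\{1,c_B\}$ and $\overline C_B=\max\{1,C_B\}$. (The existence of such constants is a known fact in this setting.) *)

theory Defs
  imports "HOL-Analysis.Analysis" "Jordan_Normal_Form.VS_Connect"
    "Jordan_Normal_Form.Gauss_Jordan_Elimination"
begin

no_notation Matrix.vec_index (infixl "$" 100)
no_notation Matrix.scalar_prod (infix "\<bullet>" 70)
unbundle inner_syntax

section \<open>Domains and meshes\<close>

text \<open>Near every boundary point, \<open>\<Omega>\<close> is the strict epigraph, in some direction \<open>e\<close>,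
  of a Lipschitz function on the hyperplane orthogonal to \<open>e\<close>.\<close>

definition lipschitz_boundary :: "'a::euclidean_space set \<Rightarrow> bool" where
  "lipschitz_boundary \<Omega> \<longleftrightarrow>
     (\<forall>x\<in>frontier \<Omega>. \<exists>r>0. \<exists>e. norm e = 1 \<and>
        (\<exists>L g. L-lipschitz_on {z. z \<bullet> e = 0} g \<and>
           \<Omega> \<inter> ball x r = {y \<in> ball x r. g (y - (y \<bullet> e) *\<^sub>R e) < y \<bullet> e}))"

text \<open>Not necessarily convex: the closure is a finite union of (convex) polytopes.\<close>

definition polytopal_domain :: "'a::euclidean_space set \<Rightarrow> bool" where
  "polytopal_domain \<Omega> \<longleftrightarrow>
     open \<Omega> \<and> bounded \<Omega> \<and> \<Omega> \<noteq> {} \<and>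
     (\<exists>F. finite F \<and> (\<forall>S\<in>F. polytope S) \<and> closure \<Omega> = \<Union>F) \<and>
     lipschitz_boundary \<Omega>"

text \<open>The library's \<^const>\<open>triangulation\<close> says that the intersection of two elements is a
  (possibly empty) face of each; elements are closed simplices.\<close>

definition matching_mesh :: "'a::euclidean_space set \<Rightarrow> 'a set set \<Rightarrow> bool" where
  "matching_mesh \<Omega> \<T> \<longleftrightarrow>
     triangulation \<T> \<and> (\<forall>K\<in>\<T>. int DIM('a) simplex K) \<and> \<Union>\<T> = closure \<Omega>"

definition inscribed_diameter :: "'a::euclidean_space set \<Rightarrow> real" where
  "inscribed_diameter K = Sup {diameter (cball x r) |x r. 0 \<le> r \<and> cball x r \<subseteq> K}"

definition shape_regularity :: "'a::euclidean_space set set \<Rightarrow> real" where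
  "shape_regularity \<T> = (LEAST \<gamma>. \<forall>K\<in>\<T>. diameter K / inscribed_diameter K \<le> \<gamma>)"

text \<open>Uniform dyadic (red) refinement. Each simplex is the union of \<open>2 ^ d\<close> new ones, whose
  vertices are vertices or edge midpoints of the old one; among them is, at each vertex, the copy
  of the old simplex scaled by one half. For \<open>d = 2\<close> this determines the refinement. For
  \<open>d = 3\<close> the remaining octahedron is cut into four tetrahedra along one of its three
  diagonals, and the choice of the diagonal is left free.\<close>

definition dyadic_refinement :: "'a::euclidean_space set set \<Rightarrow> 'a set set \<Rightarrow> bool" where
  "dyadic_refinement \<T> \<T>' \<longleftrightarrow>
     (\<forall>K'\<in>\<T>'. \<exists>K\<in>\<T>. K' \<subseteq> K) \<and>
     (\<forall>K\<in>\<T>.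
        card {K'\<in>\<T>'. K' \<subseteq> K} = 2 ^ DIM('a) \<and>
        \<Union>{K'\<in>\<T>'. K' \<subseteq> K} = K \<and>
        (\<forall>a. a extreme_point_of K \<longrightarrow> midpoint a ` K \<in> \<T>') \<and>
        (\<forall>K'\<in>\<T>'. K' \<subseteq> K \<longrightarrow>
           {x. x extreme_point_of K'} \<subseteq>
           {midpoint a b |a b. a extreme_point_of K \<and> b extreme_point_of K}))"

text \<open>For \<open>d = 2\<close> all new triangles are similar to the old one with ratio one half, so the
  shape regularity is constant. For \<open>d = 3\<close> it is only bounded if the diagonals are chosen
  suitably; \<open>C\<^sub>3\<^sub>D\<close> is the constant of the refinement strategy.\<close>

definition mesh_hierarchy ::
    "real \<Rightarrow> 'a::euclidean_space set \<Rightarrow> (nat \<Rightarrow> 'a set set) \<Rightarrow> bool" where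
  "mesh_hierarchy C\<^sub>3\<^sub>D \<Omega> \<T> \<longleftrightarrow>
     polytopal_domain \<Omega> \<and>
     (\<forall>j. matching_mesh \<Omega> (\<T> j)) \<and>
     (\<forall>j. dyadic_refinement (\<T> j) (\<T> (Suc j))) \<and>
     (DIM('a) = 3 \<longrightarrow> (\<forall>j. shape_regularity (\<T> j) \<le> C\<^sub>3\<^sub>D * shape_regularity (\<T> 0)))"

text \<open>On the null set of points shared by several elements, one of them is picked. For \<open>d = 2\<close> the
  mesh size is exactly halved by each refinement; for \<open>d = 3\<close> this can fail on the tetrahedra
  inside the octahedron, whose diameter may be the length of the chosen diagonal, so exact halving
  is not made a requirement on the hierarchy.\<close>

definition mesh_size :: "'a::euclidean_space set set \<Rightarrow> 'a \<Rightarrow> real" where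
  "mesh_size \<T> x = diameter (SOME K. K \<in> \<T> \<and> x \<in> K)"


section \<open>Function spaces\<close>

text \<open>The pointwise gradient. For continuous piecewise affine functions it exists off a null set
  and is the weak gradient; its value elsewhere is irrelevant.\<close>

definition grad :: "('a::euclidean_space \<Rightarrow> real) \<Rightarrow> 'a \<Rightarrow> 'a" where
  "grad w x = (THE D. GDERIV w x :> D)"

definition L2_norm :: "'a::euclidean_space set \<Rightarrow> ('a \<Rightarrow> 'b::real_normed_vector) \<Rightarrow> real" where
  "L2_norm \<Omega> g = sqrt (LINT x:\<Omega>|lebesgue. (norm (g x))\<^sup>2)"

definition in_L2 :: "'a::euclidean_space set \<Rightarrow> ('a \<Rightarrow> real) \<Rightarrow> bool" where
  "in_L2 \<Omega> f \<longleftrightarrow>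
     set_borel_measurable lebesgue \<Omega> f \<and> set_integrable lebesgue \<Omega> (\<lambda>x. (f x)\<^sup>2)"

text \<open>Finite element functions on \<open>closure \<Omega>\<close> that vanish on the boundary are extended by zero
  to the whole space, so that equality of functions is equality on \<open>closure \<Omega>\<close>.\<close>

definition fe_space :: "'a::euclidean_space set \<Rightarrow> 'a set set \<Rightarrow> ('a \<Rightarrow> real) set" where
  "fe_space \<Omega> \<T> =
     {w. continuous_on (closure \<Omega>) w \<and>
         (\<forall>K\<in>\<T>. \<exists>g b. \<forall>x\<in>K. w x = g \<bullet> x + b) \<and>
         (\<forall>x. x \<notin> \<Omega> \<longrightarrow> w x = 0)}"

definition free_nodes :: "'a::euclidean_space set \<Rightarrow> 'a set set \<Rightarrow> 'a set" where
  "free_nodes \<Omega> \<T> = {x. \<exists>K\<in>\<T>. x extreme_point_of K} - frontier \<Omega>"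

definition hat :: "'a::euclidean_space set \<Rightarrow> 'a set set \<Rightarrow> 'a \<Rightarrow> 'a \<Rightarrow> real" where
  "hat \<Omega> \<T> z = (THE \<phi>. \<phi> \<in> fe_space \<Omega> \<T> \<and>
     (\<forall>y\<in>free_nodes \<Omega> \<T>. \<phi> y = (if y = z then 1 else 0)))"


section \<open>The constants of the multilevel splitting\<close>

definition stable_splitting ::
    "real \<Rightarrow> real \<Rightarrow> 'a::euclidean_space set \<Rightarrow> (nat \<Rightarrow> 'a set set) \<Rightarrow> bool" where
  "stable_splitting c C \<Omega> \<T> \<longleftrightarrow> 0 < c \<and> 0 < C \<and>
     (\<forall>J. \<forall>w\<in>fe_space \<Omega> (\<T> J).
        let E = (INF ws \<in> {ws. (\<forall>j\<le>J. ws j \<in> fe_space \<Omega> (\<T> j)) \<and>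
                               w = (\<lambda>x. \<Sum>j\<le>J. ws j x)}.
                  (L2_norm \<Omega> (grad (ws 0)))\<^sup>2 +
                  (\<Sum>j=1..J. (L2_norm \<Omega> (\<lambda>x. inverse (mesh_size (\<T> j) x) * ws j x))\<^sup>2))
        in c * (L2_norm \<Omega> (grad w))\<^sup>2 \<le> E \<and> E \<le> C * (L2_norm \<Omega> (grad w))\<^sup>2)"

text \<open>The component of \<open>w\<close> in the span of the hat function of node \<open>z\<close> is \<open>a z\<close> times
  that hat function.\<close>

definition stable_basis ::
    "real \<Rightarrow> real \<Rightarrow> 'a::euclidean_space set \<Rightarrow> (nat \<Rightarrow> 'a set set) \<Rightarrow> bool" where
  "stable_basis c C \<Omega> \<T> \<longleftrightarrow> 0 < c \<and> 0 < C \<and>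
     (\<forall>j a. \<forall>w\<in>fe_space \<Omega> (\<T> j).
        w = (\<lambda>x. \<Sum>z\<in>free_nodes \<Omega> (\<T> j). a z * hat \<Omega> (\<T> j) z x) \<longrightarrow>
        (let H = (L2_norm \<Omega> (\<lambda>x. inverse (mesh_size (\<T> j) x) * w x))\<^sup>2;
             S = (\<Sum>z\<in>free_nodes \<Omega> (\<T> j).
                    (L2_norm \<Omega> (grad (\<lambda>x. a z * hat \<Omega> (\<T> j) z x)))\<^sup>2)
         in c * H \<le> S \<and> S \<le> C * H))"


section \<open>Galerkin solution, residual and its algebraic representation\<close>

definition galerkin_solution ::
    "'a::euclidean_space set \<Rightarrow> 'a set set \<Rightarrow> ('a \<Rightarrow> real) \<Rightarrow> ('a \<Rightarrow> real) \<Rightarrow> bool" where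
  "galerkin_solution \<Omega> \<T> f u \<longleftrightarrow> u \<in> fe_space \<Omega> \<T> \<and>
     (\<forall>w\<in>fe_space \<Omega> \<T>.
        (LINT x:\<Omega>|lebesgue. grad u x \<bullet> grad w x) = (LINT x:\<Omega>|lebesgue. f x * w x))"

definition residual ::
    "'a::euclidean_space set \<Rightarrow> ('a \<Rightarrow> real) \<Rightarrow> ('a \<Rightarrow> real) \<Rightarrow> ('a \<Rightarrow> real) \<Rightarrow> real" where
  "residual \<Omega> f v w = (LINT x:\<Omega>|lebesgue. f x * w x - grad v x \<bullet> grad w x)"

text \<open>Vectors and matrices are indexed from \<open>0\<close>, along an enumeration \<open>p\<close> of the free nodes.\<close>

definition enumerates :: "(nat \<Rightarrow> 'a) \<Rightarrow> 'a set \<Rightarrow> bool" where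
  "enumerates p S \<longleftrightarrow> bij_betw p {..<card S} S"

definition residual_vector ::
    "'a::euclidean_space set \<Rightarrow> 'a set set \<Rightarrow> (nat \<Rightarrow> 'a) \<Rightarrow> ('a \<Rightarrow> real) \<Rightarrow> ('a \<Rightarrow> real) \<Rightarrow>
     real Matrix.vec" where
  "residual_vector \<Omega> \<T> p f v =
     Matrix.vec (card (free_nodes \<Omega> \<T>)) (\<lambda>m. residual \<Omega> f v (hat \<Omega> \<T> (p m)))"

definition stiffness_matrix ::
    "'a::euclidean_space set \<Rightarrow> 'a set set \<Rightarrow> (nat \<Rightarrow> 'a) \<Rightarrow> real Matrix.mat" where
  "stiffness_matrix \<Omega> \<T> p =
     Matrix.mat (card (free_nodes \<Omega> \<T>)) (card (free_nodes \<Omega> \<T>))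
       (\<lambda>(m, n). LINT x:\<Omega>|lebesgue. grad (hat \<Omega> \<T> (p n)) x \<bullet> grad (hat \<Omega> \<T> (p m)) x)"

definition stiffness_diagonal ::
    "'a::euclidean_space set \<Rightarrow> 'a set set \<Rightarrow> (nat \<Rightarrow> 'a) \<Rightarrow> real Matrix.mat" where
  "stiffness_diagonal \<Omega> \<T> p =
     mat_diag (card (free_nodes \<Omega> \<T>))
       (\<lambda>m. LINT x:\<Omega>|lebesgue. grad (hat \<Omega> \<T> (p m)) x \<bullet> grad (hat \<Omega> \<T> (p m)) x)"


section \<open>Preconditioned conjugate gradients\<close>

text \<open>Meaningful for invertible matrices only, on which \<^const>\<open>mat_inverse\<close> returns
  \<^term>\<open>Some\<close> of the inverse.\<close>

definition mat_inv :: "real Matrix.mat \<Rightarrow> real Matrix.mat" where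
  "mat_inv A = the (mat_inverse A)"

definition quad_form :: "real Matrix.mat \<Rightarrow> real Matrix.vec \<Rightarrow> real" where
  "quad_form A v = Matrix.scalar_prod v (A *\<^sub>v v)"

definition energy_norm :: "real Matrix.mat \<Rightarrow> real Matrix.vec \<Rightarrow> real" where
  "energy_norm A v = sqrt (quad_form A v)"

definition spd_matrix :: "nat \<Rightarrow> real Matrix.mat \<Rightarrow> bool" where
  "spd_matrix n P \<longleftrightarrow> P \<in> carrier_mat n n \<and> transpose_mat P = P \<and>
     (\<forall>v\<in>carrier_vec n. v \<noteq> 0\<^sub>v n \<longrightarrow> 0 < quad_form P v)"

definition krylov_space ::
    "nat \<Rightarrow> real Matrix.mat \<Rightarrow> real Matrix.mat \<Rightarrow> real Matrix.vec \<Rightarrow> nat \<Rightarrow> real Matrix.vec set" where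
  "krylov_space n P A r m =
     LinearCombinations.module.span class_ring (module_vec TYPE(real) n)
       {((mat_inv P * A) ^\<^sub>m k) *\<^sub>v (mat_inv P *\<^sub>v r) |k. k < m}"

text \<open>Exact arithmetic and zero initial guess: the \<open>m\<close>-th iterate minimizes the energy norm of
  the error over the \<open>m\<close>-th Krylov space.\<close>

definition pcg_iterates ::
    "nat \<Rightarrow> real Matrix.mat \<Rightarrow> real Matrix.mat \<Rightarrow> real Matrix.vec \<Rightarrow> (nat \<Rightarrow> real Matrix.vec) \<Rightarrow> bool" where
  "pcg_iterates n P A r c \<longleftrightarrow>
     (\<forall>m. is_arg_min (\<lambda>y. energy_norm A (mat_inv A *\<^sub>v r - y))
            (\<lambda>y. y \<in> krylov_space n P A r m) (c m))"

end

theory Submission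
  imports Defs
begin

text \<open>The proof separates analysis and linear algebra through one number, the estimator
  \<open>\<Sum>j\<le>J. r\<^sub>j\<^sup>* M\<^sub>j\<^sup>-\<^sup>1 r\<^sub>j\<close>, where \<open>M\<^sub>0\<close> is the coarsest stiffness matrix and \<open>M\<^sub>j\<close> is
  the diagonal matrix of level \<open>j \<ge> 1\<close>.

  On the finest finite element space the residual is the energy product with the discrete error
  \<open>e = u - v\<close> (\<open>residual_galerkin\<close>). Testing \<open>e\<close> with itself along an arbitrary splitting into levels,
  and using Cauchy--Schwarz on each level, shows that the energy of \<open>e\<close> is at most \<open>C\<^sub>S max(1, C\<^sub>B)\<close>
  times the estimator (\<open>error_le_estimator\<close>). Conversely, the sum \<open>w\<close> of the corrections with
  coefficients \<open>M\<^sub>j\<^sup>-\<^sup>1 r\<^sub>j\<close> turns the estimator into the energy product of \<open>e\<close> and \<open>w\<close>, and the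
  energy of \<open>w\<close> is itself controlled by the estimator, which gives the lower bound with
  \<open>c\<^sub>S min(1, c\<^sub>B)\<close> (\<open>estimator_le_error\<close>).

  The conjugate gradient iterates enter only through the Pythagorean identity
  \<open>r\<^sub>0\<^sup>* A\<^sub>0\<^sup>-\<^sup>1 r\<^sub>0 = \<mu>\<^sub>i\<^sup>2 + \<parallel>c\<^sub>0 - c\<^sub>0\<^sup>i\<parallel>\<^sup>2\<close> (\<open>pcg_energy_identity\<close>): the coarsest term of the
  estimator lies between \<open>\<mu>\<^sub>i\<^sup>2\<close> and \<open>\<mu>\<^sub>i\<^sup>2 + \<zeta>\<^sup>2\<close>.

  Translating between functions and vectors requires that the hat functions exist and form a basis
  (\<open>hat_function_exists\<close>, \<open>fe_space_nodal_expansion\<close>), and that the energy is definite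
  (\<open>energy_definite\<close>), so that the inverse matrices are meaningful.\<close>

section \<open>Finite element spaces and their hat functions\<close>

text \<open>A Lipschitz domain lies on one side of its boundary: just below a boundary point, against the
  direction \<open>e\<close> of the local epigraph, there is an open set that avoids \<open>\<Omega>\<close>. Without this (think of
  a slit) a mesh of \<open>closure \<Omega>\<close> could not see the boundary.\<close>

lemma interior_closure_polytopal_domain:
  assumes "polytopal_domain \<Omega>"
  shows "interior (closure \<Omega>) \<subseteq> \<Omega>"
proof
  fix x assume xi: "x \<in> interior (closure \<Omega>)"
  show "x \<in> \<Omega>"
  proof (rule ccontr)
    assume xn: "x \<notin> \<Omega>"
    have "open \<Omega>" using assms by (simp add: polytopal_domain_def)
    then have "x \<in> frontier \<Omega>"
      using xi xn by (auto simp: frontier_def interior_open dest: interior_subset[THEN subsetD])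
    then obtain r e L g where r: "r > 0" and e: "norm e = 1"
      and L: "L-lipschitz_on {z. z \<bullet> e = 0} g"
      and eq: "\<Omega> \<inter> ball x r = {y \<in> ball x r. g (y - (y \<bullet> e) *\<^sub>R e) < y \<bullet> e}"
      using assms unfolding polytopal_domain_def lipschitz_boundary_def by blast
    let ?q = "\<lambda>y. y - (y \<bullet> e) *\<^sub>R e"
    have ee: "e \<bullet> e = 1" using e by (simp add: dot_square_norm)
    have cg: "continuous_on UNIV (\<lambda>y. g (?q y))"
      by (rule continuous_on_compose2[OF lipschitz_on_continuous_on[OF L]])
        (auto intro!: continuous_intros simp: inner_diff_left ee)
    define U where "U = ball x r \<inter> {y. y \<bullet> e < g (?q y)}"
    have "open U" unfolding U_def
      by (intro open_Int open_ball open_Collect_less cg continuous_intros)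
    have "y \<notin> \<Omega>" if "y \<in> U" for y
    proof
      assume "y \<in> \<Omega>"
      then have "y \<in> \<Omega> \<inter> ball x r" using that by (simp add: U_def)
      then have "g (?q y) < y \<bullet> e" unfolding eq by simp
      then show False using that by (simp add: U_def)
    qed
    then have "U \<inter> \<Omega> = {}" by blast
    with \<open>open U\<close> have U: "U \<inter> closure \<Omega> = {}" by (simp add: open_Int_closure_eq_empty)
    obtain s where s: "s > 0" "ball x s \<subseteq> closure \<Omega>" using xi by (auto simp: mem_interior)
    define t where "t = min r s / 2"
    define y where "y = x - t *\<^sub>R e"
    have t: "0 < t" "t < r" "t < s" using r s by (auto simp: t_def)
    have "dist x y = t" using t e by (simp add: y_def dist_norm)
    then have y: "y \<in> ball x r" "y \<in> ball x s" using t by auto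
    have ye: "y \<bullet> e = x \<bullet> e - t" by (simp add: y_def inner_diff_left ee)
    have q: "?q y = ?q x" unfolding ye by (simp add: y_def algebra_simps)
    have "x \<notin> {y \<in> ball x r. g (?q y) < y \<bullet> e}" unfolding eq[symmetric] using xn by simp
    then have "x \<bullet> e \<le> g (?q x)" using r by (simp add: not_less)
    with q y(1) t ye have "y \<in> U" by (simp add: U_def)
    then show False using U y s by auto
  qed
qed

text \<open>Barycentric coordinates of a full-dimensional simplex as affine functions on the whole space. The
  coordinate of a vertex comes from the hyperplane spanned by the opposite face. Knowing that the
  simplex is exactly the set where all of them are nonnegative turns questions about neighbourhoods
  in a mesh into linear inequalities.\<close>

lemma simplex_barycentric:
  fixes K :: "'a::euclidean_space set"
  assumes "int DIM('a) simplex K"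
  defines "V \<equiv> {x. x extreme_point_of K}"
  shows "\<exists>g b. (\<forall>c\<in>V. \<forall>y\<in>V. g c \<bullet> y + b c = (if y = c then 1 else (0::real))) \<and>
    (\<forall>x. x \<in> K \<longleftrightarrow> (\<forall>c\<in>V. 0 \<le> g c \<bullet> x + b c))"
proof -
  obtain C where C: "finite C" "\<not> affine_dependent C" "int (card C) = int DIM('a) + 1"
    "K = convex hull C" using assms by (auto simp: simplex)
  have ext: "V = C"
    unfolding V_def using extreme_point_of_convex_hull_affine_independent[OF C(2)] C(4) by auto
  have "\<exists>a \<beta>. \<forall>y\<in>C. a \<bullet> y + \<beta> = (if y = z then 1 else (0::real))" if z: "z \<in> C" for z
  proof -
    have ind: "\<not> affine_dependent (C - {z})" using C(2) affine_independent_Diff by blast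
    have "aff_dim (C - {z}) = int (card (C - {z})) - 1"
      using aff_dim_affine_independent[OF ind] by simp
    also have "\<dots> = int DIM('a) - 1" using C z by (simp add: of_nat_diff)
    also have "\<dots> = int (DIM('a) - 1)" using DIM_positive[where 'a='a] by (simp add: of_nat_diff)
    finally obtain a \<beta> where a: "affine hull (C - {z}) = {x. a \<bullet> x = \<beta>}"
      using aff_dim_eq_hyperplane by blast
    have "z \<notin> affine hull (C - {z})" using C(2) z by (auto simp: affine_dependent_def)
    then have nz: "a \<bullet> z - \<beta> \<noteq> 0" using a by auto
    have "a \<bullet> y = \<beta>" if "y \<in> C" "y \<noteq> z" for y
      using hull_inc[of y "C - {z}" affine] that a by auto
    then have "\<forall>y\<in>C. (a /\<^sub>R (a \<bullet> z - \<beta>)) \<bullet> y + - (\<beta> / (a \<bullet> z - \<beta>)) = (if y = z then 1 else 0)"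
      using nz by (auto simp: divide_simps)
    then show ?thesis by blast
  qed
  then obtain g b where gb: "\<And>z y. z \<in> C \<Longrightarrow> y \<in> C \<Longrightarrow> g z \<bullet> y + b z = (if y = z then 1 else (0::real))"
    by metis
  have coord: "g z \<bullet> x + b z = u z"
    if "z \<in> C" "sum u C = 1" "(\<Sum>c\<in>C. u c *\<^sub>R c) = x" for z x u
  proof -
    have "g z \<bullet> x + b z = (\<Sum>c\<in>C. u c * (g z \<bullet> c)) + (\<Sum>c\<in>C. u c) * b z"
      using that by (auto simp: inner_sum_right)
    also have "\<dots> = (\<Sum>c\<in>C. u c * (g z \<bullet> c + b z))"
      by (simp add: sum_distrib_right distrib_left sum.distrib)
    also have "\<dots> = (\<Sum>c\<in>C. if c = z then u c else 0)"
      using gb \<open>z \<in> C\<close> by (intro sum.cong) auto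
    finally show ?thesis using C(1) \<open>z \<in> C\<close> by simp
  qed
  have "aff_dim C = int DIM('a)" using aff_dim_affine_independent[OF C(2)] C(3) by simp
  then have "affine hull C = UNIV" by (simp add: aff_dim_eq_full)
  then have bary: "(\<Sum>z\<in>C. (g z \<bullet> x + b z) *\<^sub>R z) = x" "(\<Sum>z\<in>C. g z \<bullet> x + b z) = 1" for x
  proof -
    obtain u where u: "sum u C = 1" "(\<Sum>c\<in>C. u c *\<^sub>R c) = x"
      using affine_hull_finite[OF C(1)] \<open>affine hull C = UNIV\<close> UNIV_I[of x] by auto
    then have "g z \<bullet> x + b z = u z" if "z \<in> C" for z using coord that by blast
    then show "(\<Sum>z\<in>C. (g z \<bullet> x + b z) *\<^sub>R z) = x" "(\<Sum>z\<in>C. g z \<bullet> x + b z) = 1"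
      using u by simp_all
  qed
  have mem: "x \<in> K \<longleftrightarrow> (\<forall>z\<in>C. 0 \<le> g z \<bullet> x + b z)" for x
  proof
    assume "x \<in> K"
    then obtain u where u: "\<forall>c\<in>C. 0 \<le> u c" "sum u C = 1" "(\<Sum>c\<in>C. u c *\<^sub>R c) = x"
      using C(4) convex_hull_finite[OF C(1)] by auto
    then have "g z \<bullet> x + b z = u z" if "z \<in> C" for z using coord that by blast
    then show "\<forall>z\<in>C. 0 \<le> g z \<bullet> x + b z" using u(1) by simp
  next
    assume "\<forall>z\<in>C. 0 \<le> g z \<bullet> x + b z"
    then show "x \<in> K" unfolding C(4) convex_hull_finite[OF C(1)]
      using bary[of x] by (intro CollectI exI[of _ "\<lambda>z. g z \<bullet> x + b z"]) simp
  qed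
  show ?thesis unfolding ext using gb mem by (intro exI[of _ g] exI[of _ b]) simp
qed

lemma affine_eq_on_convex_hull:
  fixes S :: "'a::euclidean_space set"
  assumes "\<And>y. y \<in> S \<Longrightarrow> g \<bullet> y + b = g' \<bullet> y + b'" and "x \<in> convex hull S"
  shows "g \<bullet> x + b = g' \<bullet> x + b'"
proof -
  have "convex hull S \<subseteq> {x. (g - g') \<bullet> x = b' - b}"
  proof (rule hull_minimal)
    show "S \<subseteq> {x. (g - g') \<bullet> x = b' - b}"
      using assms(1) by (force simp: inner_diff_left algebra_simps)
  qed (rule convex_hyperplane)
  then show ?thesis using assms(2) by (auto simp: inner_diff_left)
qed

lemma matching_meshD:
  assumes "matching_mesh \<Omega> \<T>"
  shows "finite \<T>" "\<Union>\<T> = closure \<Omega>"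
    "\<And>K. K \<in> \<T> \<Longrightarrow> int DIM('a) simplex (K :: 'a::euclidean_space set)"
    "\<And>K. K \<in> \<T> \<Longrightarrow> compact K" "\<And>K. K \<in> \<T> \<Longrightarrow> closed K" "\<And>K. K \<in> \<T> \<Longrightarrow> convex K"
    "\<And>K K'. K \<in> \<T> \<Longrightarrow> K' \<in> \<T> \<Longrightarrow> K \<inter> K' face_of K"
proof -
  show "finite \<T>" "\<Union>\<T> = closure \<Omega>" and simp: "\<And>K. K \<in> \<T> \<Longrightarrow> int DIM('a) simplex K"
    using assms by (auto simp: matching_mesh_def triangulation_def)
  show "\<And>K. K \<in> \<T> \<Longrightarrow> compact K" "\<And>K. K \<in> \<T> \<Longrightarrow> closed K" "\<And>K. K \<in> \<T> \<Longrightarrow> convex K"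
    using simp compact_simplex closed_simplex convex_simplex by blast+
  show "K \<inter> K' face_of K" if "K \<in> \<T>" "K' \<in> \<T>" for K K'
    using assms that by (simp add: matching_mesh_def triangulation_def)
qed

lemma simplex_hull_extreme_points:
  assumes "n simplex K"
  shows "finite {x. x extreme_point_of K}" "K = convex hull {x. x extreme_point_of K}"
proof -
  obtain C where C: "finite C" "\<not> affine_dependent C" "K = convex hull C"
    using assms by (auto simp: simplex)
  then have "{x. x extreme_point_of K} = C"
    by (auto simp: extreme_point_of_convex_hull_affine_independent)
  then show "finite {x. x extreme_point_of K}" "K = convex hull {x. x extreme_point_of K}"
    using C by auto
qed

lemma fe_space_affineE:
  assumes "w \<in> fe_space \<Omega> \<T>" "K \<in> \<T>"
  obtains g b where "\<forall>x\<in>K. w x = g \<bullet> x + b"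
proof -
  have "\<exists>g b. \<forall>x\<in>K. w x = g \<bullet> x + b" using assms unfolding fe_space_def by fast
  then show thesis using that by fast
qed

text \<open>Uniqueness half of nodal interpolation: a vertex is either free or lies on the boundary, where
  the functions vanish anyway.\<close>

lemma fe_space_eq_zero:
  assumes dom: "polytopal_domain \<Omega>" and mesh: "matching_mesh \<Omega> \<T>" and w: "w \<in> fe_space \<Omega> \<T>"
    and nodes: "\<And>y. y \<in> free_nodes \<Omega> \<T> \<Longrightarrow> w y = 0"
  shows "w = (\<lambda>x. 0)"
proof
  fix x
  have op: "open \<Omega>" using dom by (simp add: polytopal_domain_def)
  show "w x = 0"
  proof (cases "x \<in> closure \<Omega>")
    case True
    then obtain K where K: "K \<in> \<T>" "x \<in> K" using matching_meshD(2)[OF mesh] by blast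
    obtain g b where gb: "\<forall>x\<in>K. w x = g \<bullet> x + b"
    by (rule fe_space_affineE[OF w K(1)])
    have hull: "K = convex hull {x. x extreme_point_of K}"
      using simplex_hull_extreme_points(2) matching_meshD(3)[OF mesh K(1)] by blast
    have eq0: "g \<bullet> y + b = 0 \<bullet> y + 0" if y: "y \<in> {x. x extreme_point_of K}" for y
    proof -
      have "w y = 0"
      proof (cases "y \<in> frontier \<Omega>")
        case True
        then show ?thesis using op w by (auto simp: fe_space_def frontier_def interior_open)
      next
        case False
        then show ?thesis using nodes[of y] y K by (auto simp: free_nodes_def)
      qed
      then show ?thesis using gb y by (auto simp: extreme_point_of_def)
    qed
    have "x \<in> convex hull {x. x extreme_point_of K}" using hull K(2) by blast
    with eq0 have "g \<bullet> x + b = 0 \<bullet> x + 0" by (rule affine_eq_on_convex_hull)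
    then show ?thesis using gb K(2) by simp
  next
    case False
    then have "x \<notin> \<Omega>" using closure_subset by blast
    then show ?thesis using w by (simp add: fe_space_def)
  qed
qed

lemma fe_space_0: "(\<lambda>x::'a::euclidean_space. 0) \<in> fe_space \<Omega> \<T>"
proof -
  have "\<exists>g b. \<forall>x\<in>K. (0::real) = g \<bullet> x + b" for K :: "'a set"
    by (rule exI[of _ 0], rule exI[of _ 0]) simp
  then show ?thesis unfolding fe_space_def by (intro CollectI conjI ballI allI impI continuous_on_const refl)
qed

lemma fe_space_add:
  assumes "v \<in> fe_space \<Omega> \<T>" "w \<in> fe_space \<Omega> \<T>"
  shows "(\<lambda>x. v x + w x) \<in> fe_space \<Omega> \<T>"
  unfolding fe_space_def
proof (intro CollectI conjI ballI allI impI)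
  fix K assume "K \<in> \<T>"
  obtain g b where gb: "\<forall>x\<in>K. v x = g \<bullet> x + b"
    by (rule fe_space_affineE[OF assms(1) \<open>K \<in> \<T>\<close>])
  obtain g' b'
    where gb': "\<forall>x\<in>K. w x = g' \<bullet> x + b'"
    by (rule fe_space_affineE[OF assms(2) \<open>K \<in> \<T>\<close>])
  from gb gb' show "\<exists>g b. \<forall>x\<in>K. v x + w x = g \<bullet> x + b"
    by (intro exI[of _ "g + g'"] exI[of _ "b + b'"]) (simp add: inner_add_left)
qed (use assms in \<open>simp_all add: fe_space_def continuous_on_add continuous_on_mult_left\<close>)

lemma fe_space_scale:
  assumes "w \<in> fe_space \<Omega> \<T>"
  shows "(\<lambda>x. a * w x) \<in> fe_space \<Omega> \<T>"
  unfolding fe_space_def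
proof (intro CollectI conjI ballI allI impI)
  fix K assume "K \<in> \<T>"
  obtain g b where "\<forall>x\<in>K. w x = g \<bullet> x + b"
    by (rule fe_space_affineE[OF assms \<open>K \<in> \<T>\<close>])
  then show "\<exists>g b. \<forall>x\<in>K. a * w x = g \<bullet> x + b"
    by (intro exI[of _ "a *\<^sub>R g"] exI[of _ "a * b"]) (simp add: distrib_left)
qed (use assms in \<open>simp_all add: fe_space_def continuous_on_add continuous_on_mult_left\<close>)

lemma fe_space_sum:
  assumes "\<And>i. i \<in> I \<Longrightarrow> w i \<in> fe_space \<Omega> \<T>"
  shows "(\<lambda>x. \<Sum>i\<in>I. w i x) \<in> fe_space \<Omega> \<T>"
  using assms
  by (induction I rule: infinite_finite_induct) (simp_all add: fe_space_0 fe_space_add)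

lemma fe_space_diff:
  assumes "v \<in> fe_space \<Omega> \<T>" "w \<in> fe_space \<Omega> \<T>"
  shows "(\<lambda>x. v x - w x) \<in> fe_space \<Omega> \<T>"
  using fe_space_add[OF assms(1) fe_space_scale[OF assms(2), of "-1"]] by simp

lemma fe_space_mono:
  assumes "\<And>K'. K' \<in> \<T>' \<Longrightarrow> \<exists>K\<in>\<T>. K' \<subseteq> K"
  shows "fe_space \<Omega> \<T> \<subseteq> fe_space \<Omega> \<T>'"
proof
  fix w assume w: "w \<in> fe_space \<Omega> \<T>"
  have "\<exists>g b. \<forall>x\<in>K'. w x = g \<bullet> x + b" if K': "K' \<in> \<T>'" for K'
  proof -
    obtain K where K: "K \<in> \<T>" "K' \<subseteq> K" using assms[OF K'] by blast
    obtain g b where "\<forall>x\<in>K. w x = g \<bullet> x + b"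
    by (rule fe_space_affineE[OF w K(1)])
    then show ?thesis using K(2) by (intro exI[of _ g] exI[of _ b]) auto
  qed
  then show "w \<in> fe_space \<Omega> \<T>'" using w by (simp add: fe_space_def)
qed

lemma finite_free_nodes:
  assumes "matching_mesh \<Omega> \<T>"
  shows "finite (free_nodes \<Omega> \<T>)"
proof -
  have "free_nodes \<Omega> \<T> \<subseteq> (\<Union>K\<in>\<T>. {x. x extreme_point_of K})" by (auto simp: free_nodes_def)
  moreover have "finite \<dots>"
    using matching_meshD(1,3)[OF assms] by (auto intro: simplex_hull_extreme_points(1))
  ultimately show ?thesis by (rule finite_subset)
qed

text \<open>Existence half of nodal interpolation. The barycentric coordinates of \<open>z\<close> in the elements around
  \<open>z\<close>, extended by zero, fit together along common faces. The delicate point is that the result \<open>\<phi>\<close>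
  vanishes on the boundary, for which the matching property and the Lipschitz boundary are both
  needed. If \<open>\<phi> x > 0\<close>, move from \<open>x\<close> almost all the way to \<open>z\<close>, to a point \<open>w\<close> of the open set
  \<open>\<Omega>\<close>. Every element containing \<open>w\<close> contains \<open>x\<close> and \<open>z\<close> by the face property. Hence the
  homothety with centre \<open>z\<close> that takes \<open>w\<close> back to \<open>x\<close> transports the full neighbourhood of \<open>w\<close>,
  which these elements cover, to a neighbourhood of \<open>x\<close>: it keeps the signs of all barycentric
  coordinates except that of \<open>z\<close>, and that one is positive near \<open>x\<close>. So \<open>x\<close> is an interior point of
  \<open>closure \<Omega>\<close> and thus lies in \<open>\<Omega>\<close>.\<close>

lemma hat_function_exists:
  fixes \<Omega> :: "'a::euclidean_space set"
  assumes dom: "polytopal_domain \<Omega>" and mesh: "matching_mesh \<Omega> \<T>" and z: "z \<in> free_nodes \<Omega> \<T>"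
  shows "\<exists>\<phi>\<in>fe_space \<Omega> \<T>. \<forall>y\<in>free_nodes \<Omega> \<T>. \<phi> y = (if y = z then 1 else 0)"
proof -
  note meshD = matching_meshD[OF mesh]
  define V where "V K = {x. x extreme_point_of K}" for K :: "'a set"
  have "\<forall>K\<in>\<T>. \<exists>g b. (\<forall>c\<in>V K. \<forall>y\<in>V K. g c \<bullet> y + b c = (if y = c then 1 else (0::real))) \<and>
      (\<forall>x. x \<in> K \<longleftrightarrow> (\<forall>c\<in>V K. 0 \<le> g c \<bullet> x + b c))"
    unfolding V_def by (intro ballI simplex_barycentric meshD(3))
  from bchoice[OF this] obtain g where
    "\<forall>K\<in>\<T>. \<exists>b. (\<forall>c\<in>V K. \<forall>y\<in>V K. g K c \<bullet> y + b c = (if y = c then 1 else (0::real))) \<and>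
      (\<forall>x. x \<in> K \<longleftrightarrow> (\<forall>c\<in>V K. 0 \<le> g K c \<bullet> x + b c))" ..
  from bchoice[OF this] obtain b where
    gb: "\<forall>K\<in>\<T>. (\<forall>c\<in>V K. \<forall>y\<in>V K. g K c \<bullet> y + b K c = (if y = c then 1 else (0::real))) \<and>
      (\<forall>x. x \<in> K \<longleftrightarrow> (\<forall>c\<in>V K. 0 \<le> g K c \<bullet> x + b K c))" ..
  have bary: "g K c \<bullet> y + b K c = (if y = c then 1 else 0)" if "K \<in> \<T>" "c \<in> V K" "y \<in> V K" for K c y
    using gb that by blast
  have mem: "x \<in> K \<longleftrightarrow> (\<forall>c\<in>V K. 0 \<le> g K c \<bullet> x + b K c)" if "K \<in> \<T>" for K x
    using gb that by blast
  have VK: "V K \<subseteq> K" for K by (auto simp: V_def extreme_point_of_def)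
  have VI: "V (K \<inter> K') = V K \<inter> K'" if "K \<in> \<T>" "K' \<in> \<T>" for K K'
    using extreme_point_of_face[OF meshD(7)[OF that]] VK by (auto simp: V_def extreme_point_of_def)
  have VI': "V (K \<inter> K') \<subseteq> V K'" if "K \<in> \<T>" "K' \<in> \<T>" for K K'
    using VI[OF that(2,1)] by (auto simp: Int_commute)
  define G where "G K = (if z \<in> V K then g K z else 0)" for K
  define B where "B K = (if z \<in> V K then b K z else 0)" for K
  have nodal: "G K \<bullet> y + B K = (if y = z then 1 else 0)" if "K \<in> \<T>" "y \<in> V K" for K y
    using that bary by (auto simp: G_def B_def)
  have agree: "G K \<bullet> x + B K = G K' \<bullet> x + B K'" if "K \<in> \<T>" "K' \<in> \<T>" "x \<in> K" "x \<in> K'" for K K' x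
  proof (rule affine_eq_on_convex_hull)
    fix y assume "y \<in> V (K \<inter> K')"
    then show "G K \<bullet> y + B K = G K' \<bullet> y + B K'"
      using nodal[OF that(1), of y] nodal[OF that(2), of y] VI[OF that(1,2)] VI'[OF that(1,2)] by auto
  next
    have "compact (K \<inter> K')" "convex (K \<inter> K')"
      using meshD(4,6) that by (auto intro: compact_Int convex_Int)
    then have "K \<inter> K' = convex hull (V (K \<inter> K'))"
      unfolding V_def by (rule Krein_Milman_Minkowski)
    then show "x \<in> convex hull (V (K \<inter> K'))" using that by blast
  qed
  define \<phi> where "\<phi> x = (if x \<in> \<Union>\<T> then (let K = SOME K. K \<in> \<T> \<and> x \<in> K in G K \<bullet> x + B K) else 0)" for x
  have \<phi>: "\<phi> x = G K \<bullet> x + B K" if "K \<in> \<T>" "x \<in> K" for K x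
  proof -
    have "(SOME K. K \<in> \<T> \<and> x \<in> K) \<in> \<T> \<and> x \<in> (SOME K. K \<in> \<T> \<and> x \<in> K)"
      using that by (intro someI[where P="\<lambda>K. K \<in> \<T> \<and> x \<in> K"]) simp
    then show ?thesis using agree[of "SOME K. K \<in> \<T> \<and> x \<in> K" K x] that
      by (auto simp: \<phi>_def Let_def)
  qed
  have op: "open \<Omega>" using dom by (simp add: polytopal_domain_def)
  have z': "z \<in> \<Omega>"
  proof -
    obtain K where "K \<in> \<T>" "z \<in> V K" using z unfolding free_nodes_def V_def by blast
    then have "z \<in> closure \<Omega>" using VK meshD(2) by blast
    then show ?thesis using z op by (auto simp: free_nodes_def frontier_def interior_open)
  qed
  have vanish: "\<phi> x = 0" if "x \<notin> \<Omega>" for x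
  proof (rule ccontr)
    assume nz: "\<phi> x \<noteq> 0"
    then have "x \<in> \<Union>\<T>" by (auto simp: \<phi>_def split: if_splits)
    then obtain K where K: "K \<in> \<T>" "x \<in> K" by blast
    have zK: "z \<in> V K" using nz \<phi>[OF K] by (auto simp: G_def B_def split: if_splits)
    have xz: "x \<noteq> z" using that z' by blast
    have pos: "\<phi> x > 0"
      using mem[OF K(1)] K zK nz \<phi>[OF K] by (auto simp: G_def B_def less_le)
    \<comment> \<open>\<open>t\<close> is small enough that \<open>w = z + t (x - z)\<close> stays within distance \<open>e\<close> of \<open>z\<close>.\<close>
    obtain e where e: "e > 0" "ball z e \<subseteq> \<Omega>" using op z' open_contains_ball by blast
    define N where "N = norm (x - z)"
    define t where "t = e / (2 * (e + N))"
    have N: "N > 0" using xz by (simp add: N_def)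
    then have t: "0 < t" "t < 1" using e(1) by (simp_all add: t_def)
    have "e * N < e * (2 * (e + N))"
      using e(1) N by (intro mult_strict_left_mono) auto
    then have tN: "t * N < e" using e(1) N by (simp add: t_def divide_less_eq)
    define w where "w = z + t *\<^sub>R (x - z)"
    have "dist z w = t * N" using t by (simp add: w_def dist_norm N_def)
    then have w\<Omega>: "w \<in> \<Omega>" using e tN by auto
    have seg: "w \<in> open_segment z x"
      using xz t by (auto simp: in_segment w_def algebra_simps intro!: exI[of _ t])
    have star: "x \<in> K' \<and> z \<in> V K'" if K': "K' \<in> \<T>" "w \<in> K'" for K'
    proof -
      have zx: "z \<in> K" using zK VK by blast
      have "w \<in> closed_segment z x" using seg open_closed_segment by blast
      then have "w \<in> K" using meshD(6)[OF K(1)] zx K(2) by (meson convex_contains_segment subsetD)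
      then have "z \<in> K \<inter> K'" "x \<in> K \<inter> K'"
        using face_ofD[OF meshD(7)[OF K(1) K'(1)] seg] zx K K' by auto
      then show ?thesis using VI[OF K(1) K'(1)] VI'[OF K(1) K'(1)] zK by blast
    qed
    define U where "U = \<Omega> - \<Union>{K'\<in>\<T>. w \<notin> K'}"
    have "open U" unfolding U_def
      using meshD(1,5) op by (intro open_Diff closed_Union) auto
    moreover have "w \<in> U" using w\<Omega> by (auto simp: U_def)
    ultimately obtain \<rho> where \<rho>: "\<rho> > 0" "ball w \<rho> \<subseteq> U" using open_contains_ball by blast
    define W where "W = ball x \<rho> \<inter> (\<Inter>K'\<in>{K'\<in>\<T>. z \<in> V K' \<and> x \<in> K'}. {y. 0 < g K' z \<bullet> y + b K' z})"
    have "open W" unfolding W_def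
      using meshD(1) by (intro open_Int open_ball open_INT ballI open_Collect_less continuous_intros) auto
    moreover have "x \<in> W"
      using \<rho> pos \<phi>[of _ x] by (auto simp: W_def G_def B_def)
    moreover have "W \<subseteq> closure \<Omega>"
    proof
      fix y assume y: "y \<in> W"
      \<comment> \<open>The homothety with centre \<open>z\<close> and ratio \<open>t\<close> maps \<open>x\<close> to \<open>w\<close> and shrinks distances.\<close>
      define y' where "y' = z + t *\<^sub>R (y - z)"
      have "dist w y' = t * dist x y"
      proof -
        have "w - y' = t *\<^sub>R (x - y)" by (simp add: w_def y'_def algebra_simps)
        then show ?thesis using t by (simp add: dist_norm)
      qed
      also have "\<dots> \<le> 1 * dist x y" using t by (intro mult_right_mono) auto
      also have "\<dots> < \<rho>" using y by (simp add: W_def)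
      finally have "y' \<in> U" using \<rho> by auto
      then have "y' \<in> closure \<Omega>" using closure_subset by (auto simp: U_def)
      then obtain K' where K': "K' \<in> \<T>" "y' \<in> K'" using meshD(2) by blast
      then have "w \<in> K'" using \<open>y' \<in> U\<close> by (auto simp: U_def)
      then have st: "x \<in> K'" "z \<in> V K'" using star[OF K'(1)] by auto
      have "y \<in> K'" unfolding mem[OF K'(1)]
      proof
        fix c assume c: "c \<in> V K'"
        show "0 \<le> g K' c \<bullet> y + b K' c"
        proof (cases "c = z")
          case True
          then show ?thesis using y K' st by (auto simp: W_def intro: less_imp_le)
        next
          case False
          have "0 \<le> g K' c \<bullet> y' + b K' c" using mem[OF K'(1)] K'(2) c by blast
          also have "\<dots> = (1 - t) * (g K' c \<bullet> z + b K' c) + t * (g K' c \<bullet> y + b K' c)"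
            by (simp add: y'_def inner_add_right inner_diff_right algebra_simps)
          also have "g K' c \<bullet> z + b K' c = 0" using bary[OF K'(1) c st(2)] False by simp
          finally show ?thesis using t by (simp add: zero_le_mult_iff)
        qed
      qed
      then show "y \<in> closure \<Omega>" using K' meshD(2) by blast
    qed
    ultimately have "x \<in> interior (closure \<Omega>)" by (meson interiorI)
    then show False using interior_closure_polytopal_domain[OF dom] that by blast
  qed
  have "continuous_on (\<Union>K\<in>\<T>. K) \<phi>"
  proof (rule continuous_on_closed_Union)
    fix K assume K: "K \<in> \<T>"
    have "continuous_on K (\<lambda>x. G K \<bullet> x + B K)" by (intro continuous_intros)
    then show "continuous_on K \<phi>" using \<phi>[OF K] by (simp cong: continuous_on_cong)
  qed (use meshD in auto)
  then have "continuous_on (closure \<Omega>) \<phi>" using meshD(2) by simp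
  moreover have "\<exists>g b. \<forall>x\<in>K. \<phi> x = g \<bullet> x + b" if "K \<in> \<T>" for K
    using \<phi>[OF that] by (intro exI[of _ "G K"] exI[of _ "B K"]) simp
  ultimately have "\<phi> \<in> fe_space \<Omega> \<T>" using vanish by (simp add: fe_space_def)
  moreover have "\<phi> y = (if y = z then 1 else 0)" if y: "y \<in> free_nodes \<Omega> \<T>" for y
  proof -
    obtain K where K: "K \<in> \<T>" "y \<in> V K" using y unfolding free_nodes_def V_def by blast
    then have "y \<in> K" using VK by blast
    then show ?thesis using \<phi>[OF K(1)] nodal[OF K] by simp
  qed
  ultimately show ?thesis by blast
qed

lemma hat_properties:
  assumes dom: "polytopal_domain \<Omega>" and mesh: "matching_mesh \<Omega> \<T>" and z: "z \<in> free_nodes \<Omega> \<T>"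
  shows "hat \<Omega> \<T> z \<in> fe_space \<Omega> \<T>"
    and "y \<in> free_nodes \<Omega> \<T> \<Longrightarrow> hat \<Omega> \<T> z y = (if y = z then 1 else 0)"
proof -
  let ?P = "\<lambda>\<phi>. \<phi> \<in> fe_space \<Omega> \<T> \<and> (\<forall>y\<in>free_nodes \<Omega> \<T>. \<phi> y = (if y = z then 1 else 0))"
  obtain \<phi> where \<phi>: "?P \<phi>" using hat_function_exists[OF assms] by blast
  have "\<psi> = \<phi>" if \<psi>: "?P \<psi>" for \<psi>
  proof -
    have "(\<lambda>x. \<psi> x - \<phi> x) = (\<lambda>x. 0)"
      using \<phi> \<psi> by (intro fe_space_eq_zero[OF dom mesh] fe_space_diff) auto
    then show ?thesis by (auto simp: fun_eq_iff)
  qed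
  with \<phi> have "?P (hat \<Omega> \<T> z)" unfolding hat_def by (rule theI)
  then show "hat \<Omega> \<T> z \<in> fe_space \<Omega> \<T>"
    "y \<in> free_nodes \<Omega> \<T> \<Longrightarrow> hat \<Omega> \<T> z y = (if y = z then 1 else 0)" by blast+
qed

lemma fe_space_nodal_expansion:
  assumes dom: "polytopal_domain \<Omega>" and mesh: "matching_mesh \<Omega> \<T>" and w: "w \<in> fe_space \<Omega> \<T>"
  shows "w = (\<lambda>x. \<Sum>z\<in>free_nodes \<Omega> \<T>. w z * hat \<Omega> \<T> z x)"
proof -
  let ?N = "free_nodes \<Omega> \<T>"
  have "(\<lambda>x. w x - (\<Sum>z\<in>?N. w z * hat \<Omega> \<T> z x)) = (\<lambda>x. 0)"
  proof (rule fe_space_eq_zero[OF dom mesh])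
    show "(\<lambda>x. w x - (\<Sum>z\<in>?N. w z * hat \<Omega> \<T> z x)) \<in> fe_space \<Omega> \<T>"
      by (intro fe_space_diff w fe_space_sum fe_space_scale hat_properties(1)[OF dom mesh])
    fix y assume y: "y \<in> ?N"
    have "(\<Sum>z\<in>?N. w z * hat \<Omega> \<T> z y) = (\<Sum>z\<in>?N. if z = y then w z else 0)"
      using hat_properties(2)[OF dom mesh] y by (intro sum.cong) auto
    then show "w y - (\<Sum>z\<in>?N. w z * hat \<Omega> \<T> z y) = 0"
      using y finite_free_nodes[OF mesh] by simp
  qed
  then have eq: "w x - (\<Sum>z\<in>?N. w z * hat \<Omega> \<T> z x) = 0" for x by (rule fun_cong)
  show ?thesis by (rule ext, rule right_minus_eq[THEN iffD1], rule eq)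
qed

section \<open>The energy product and the residual\<close>

lemma gderiv_unique:
  assumes "GDERIV w x :> D" "GDERIV w x :> E"
  shows "D = E"
proof -
  have "(\<lambda>h. h \<bullet> D) = (\<lambda>h. h \<bullet> E)"
    using assms unfolding gderiv_def by (rule has_derivative_unique)
  then show ?thesis by (metis vector_eq_ldot)
qed

lemma grad_eqI:
  assumes "GDERIV w x :> D"
  shows "grad w x = D"
  unfolding grad_def using assms gderiv_unique by (intro the_equality)

lemma set_integral_spike:
  fixes f g :: "'a::euclidean_space \<Rightarrow> real"
  assumes f: "set_integrable lebesgue S f" and N: "negligible N" "\<And>x. x \<in> S - N \<Longrightarrow> g x = f x"
  shows "set_integrable lebesgue S g" "(LINT x:S|lebesgue. g x) = (LINT x:S|lebesgue. f x)"
proof -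
  show g: "set_integrable lebesgue S g" by (rule absolutely_integrable_spike[OF f N])
  show "(LINT x:S|lebesgue. g x) = (LINT x:S|lebesgue. f x)"
    unfolding set_lebesgue_integral_eq_integral(2)[OF f] set_lebesgue_integral_eq_integral(2)[OF g]
    using integral_spike[OF N] by simp
qed

text \<open>The bilinear form whose matrix is the stiffness matrix.\<close>

definition energy :: "'a::euclidean_space set \<Rightarrow> ('a \<Rightarrow> real) \<Rightarrow> ('a \<Rightarrow> real) \<Rightarrow> real" where
  "energy \<Omega> v w = (LINT x:\<Omega>|lebesgue. grad v x \<bullet> grad w x)"

lemma energy_sym: "energy \<Omega> v w = energy \<Omega> w v"
  by (simp add: energy_def inner_commute)

lemma energy_nonneg: "0 \<le> energy \<Omega> w w"
  unfolding energy_def set_lebesgue_integral_def by (rule Bochner_Integration.integral_nonneg) simp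

lemma energy_eq_L2_norm: "(L2_norm \<Omega> (grad w))\<^sup>2 = energy \<Omega> w w"
  using energy_nonneg[of \<Omega> w] by (simp add: L2_norm_def energy_def power2_norm_eq_inner)

locale fe_mesh =
  fixes \<Omega> :: "'a::euclidean_space set" and \<T> :: "'a set set"
  assumes domain: "polytopal_domain \<Omega>" and mesh: "matching_mesh \<Omega> \<T>"
begin

lemma open_domain: "open \<Omega>" and bounded_domain: "bounded \<Omega>"
  using domain by (simp_all add: polytopal_domain_def)

lemma interior_elements_subset: "(\<Union>K\<in>\<T>. interior K) \<subseteq> \<Omega>"
proof -
  have "interior K \<subseteq> interior (closure \<Omega>)" if "K \<in> \<T>" for K
    using matching_meshD(2)[OF mesh] that by (intro interior_mono) blast
  then show ?thesis using interior_closure_polytopal_domain[OF domain] by blast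
qed

text \<open>The pointwise gradient is under control only in the open elements; up to a null set these are the
  whole domain, because the frontier of a convex set is negligible.\<close>

lemma negligible_skeleton: "negligible (closure \<Omega> - (\<Union>K\<in>\<T>. interior K))"
proof (rule negligible_subset)
  show "negligible (\<Union>K\<in>\<T>. frontier K)"
    using matching_meshD(1,6)[OF mesh] by (intro negligible_Union) (auto intro: negligible_convex_frontier)
  show "closure \<Omega> - (\<Union>K\<in>\<T>. interior K) \<subseteq> (\<Union>K\<in>\<T>. frontier K)"
  proof
    fix x assume x: "x \<in> closure \<Omega> - (\<Union>K\<in>\<T>. interior K)"
    then obtain K where K: "K \<in> \<T>" "x \<in> K" using matching_meshD(2)[OF mesh] by blast
    then have "x \<in> frontier K" using x closure_subset[of K] by (auto simp: frontier_def)
    then show "x \<in> (\<Union>K\<in>\<T>. frontier K)" using K by blast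
  qed
qed

lemma fe_function_on_element:
  assumes w: "w \<in> fe_space \<Omega> \<T>" and K: "K \<in> \<T>"
  obtains g b where "\<forall>x\<in>K. w x = g \<bullet> x + b" "\<forall>x\<in>interior K. GDERIV w x :> g"
    "\<forall>x\<in>interior K. grad w x = g"
proof -
  obtain g b where gb: "\<forall>x\<in>K. w x = g \<bullet> x + b" by (rule fe_space_affineE[OF w K])
  have "GDERIV w x :> g" if x: "x \<in> interior K" for x
    unfolding gderiv_def
  proof (rule has_derivative_transform_within_open)
    show "((\<lambda>x. g \<bullet> x + b) has_derivative (\<lambda>h. h \<bullet> g)) (at x)"
      by (auto intro!: derivative_eq_intros simp: inner_commute)
    show "g \<bullet> y + b = w y" if "y \<in> interior K" for y
      using gb that interior_subset[of K] by auto
  qed (use x in auto)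
  then show thesis using that[OF gb] grad_eqI by blast
qed

lemma fe_function_gderiv:
  assumes w: "w \<in> fe_space \<Omega> \<T>" and x: "x \<in> (\<Union>K\<in>\<T>. interior K)"
  shows "GDERIV w x :> grad w x"
proof -
  obtain K where K: "K \<in> \<T>" "x \<in> interior K" using x by blast
  obtain g b where "\<forall>x\<in>K. w x = g \<bullet> x + b" "\<forall>x\<in>interior K. GDERIV w x :> g"
    "\<forall>x\<in>interior K. grad w x = g"
    by (rule fe_function_on_element[OF w K(1)])
  then show ?thesis using K by simp
qed

lemma grad_add:
  assumes "v \<in> fe_space \<Omega> \<T>" "w \<in> fe_space \<Omega> \<T>" "x \<in> (\<Union>K\<in>\<T>. interior K)"
  shows "grad (\<lambda>x. v x + w x) x = grad v x + grad w x"
  using assms by (intro grad_eqI GDERIV_add fe_function_gderiv)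

lemma grad_scale:
  assumes "w \<in> fe_space \<Omega> \<T>" "x \<in> (\<Union>K\<in>\<T>. interior K)"
  shows "grad (\<lambda>x. a * w x) x = a *\<^sub>R grad w x"
proof (rule grad_eqI)
  show "GDERIV (\<lambda>x. a * w x) x :> a *\<^sub>R grad w x"
    using fe_function_gderiv[OF assms] unfolding gderiv_def
    by (auto intro!: derivative_eq_intros)
qed

lemma integrable_grad_inner:
  assumes v: "v \<in> fe_space \<Omega> \<T>" and w: "w \<in> fe_space \<Omega> \<T>"
  shows "set_integrable lebesgue \<Omega> (\<lambda>x. grad v x \<bullet> grad w x)"
proof -
  let ?U = "\<Union>K\<in>\<T>. interior K"
  have meas: "interior K \<in> lmeasurable" if "K \<in> \<T>" for K
    using matching_meshD(4)[OF mesh that] by (intro lmeasurable_interior compact_imp_bounded)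
  have U: "set_integrable lebesgue ?U (\<lambda>x. grad v x \<bullet> grad w x)"
  proof (rule set_integrable_UN)
    fix K assume K: "K \<in> \<T>"
    obtain g b where g: "\<forall>x\<in>K. v x = g \<bullet> x + b" "\<forall>x\<in>interior K. GDERIV v x :> g"
      "\<forall>x\<in>interior K. grad v x = g" by (rule fe_function_on_element[OF v K])
    obtain g' b' where g': "\<forall>x\<in>K. w x = g' \<bullet> x + b'" "\<forall>x\<in>interior K. GDERIV w x :> g'"
      "\<forall>x\<in>interior K. grad w x = g'" by (rule fe_function_on_element[OF w K])
    have "set_integrable lebesgue (interior K) (\<lambda>x. g \<bullet> g')"
      using meas[OF K] by (rule absolutely_integrable_on_const)
    then show "set_integrable lebesgue (interior K) (\<lambda>x. grad v x \<bullet> grad w x)"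
      by (rule set_integral_spike(1)[OF _ negligible_empty]) (simp add: g(3) g'(3))
    show "interior K \<in> sets lebesgue" using meas[OF K] by (rule fmeasurableD)
  qed (use matching_meshD(1)[OF mesh] in simp)
  have "negligible {x \<in> \<Omega> - ?U. grad v x \<bullet> grad w x \<noteq> 0}"
    by (rule negligible_subset[OF negligible_skeleton]) (use closure_subset in blast)
  moreover have "negligible {x \<in> ?U - \<Omega>. grad v x \<bullet> grad w x \<noteq> 0}"
    by (rule negligible_subset[OF negligible_empty]) (use interior_elements_subset in blast)
  ultimately show ?thesis
    using absolutely_integrable_spike_set_eq[of \<Omega> ?U "\<lambda>x. grad v x \<bullet> grad w x"] U by blast
qed

lemma fe_continuous:
  assumes "w \<in> fe_space \<Omega> \<T>"
  shows "continuous_on UNIV w"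
proof -
  have "continuous_on (closure \<Omega>) w" "\<forall>x\<in>-\<Omega>. w x = 0" using assms by (simp_all add: fe_space_def)
  moreover from this(2) have "continuous_on (-\<Omega>) w"
    by (subst continuous_on_cong[OF refl, where g="\<lambda>x. 0"]) auto
  ultimately have "continuous_on (closure \<Omega> \<union> - \<Omega>) w"
    using open_domain by (intro continuous_on_closed_Un) auto
  moreover have "closure \<Omega> \<union> - \<Omega> = UNIV" using closure_subset by blast
  ultimately show ?thesis by simp
qed

lemma integrable_load:
  assumes f: "in_L2 \<Omega> f" and w: "w \<in> fe_space \<Omega> \<T>"
  shows "set_integrable lebesgue \<Omega> (\<lambda>x. f x * w x)"
proof -
  have "compact (w ` closure \<Omega>)"
    using fe_continuous[OF w] bounded_domain
    by (intro compact_continuous_image) (auto intro: continuous_on_subset)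
  then have "bounded (w ` closure \<Omega>)" by (rule compact_imp_bounded)
  then obtain M where "\<forall>y\<in>w ` closure \<Omega>. \<bar>y\<bar> \<le> M" unfolding bounded_real by (elim exE)
  then have M: "\<bar>w x\<bar> \<le> M" if "x \<in> \<Omega>" for x
    using that closure_subset[of \<Omega>] by blast
  have lm: "\<Omega> \<in> lmeasurable" using bounded_domain open_domain by (rule lmeasurable_open)
  have "set_integrable lebesgue \<Omega> (\<lambda>x. M * (1 + (f x)\<^sup>2))"
    using f absolutely_integrable_on_const[OF lm, of "1::real"] by (auto simp: in_L2_def)
  moreover have "set_borel_measurable lebesgue \<Omega> (\<lambda>x. f x * w x)"
  proof -
    have "w \<in> borel_measurable lebesgue"
      using fe_continuous[OF w] by (intro measurable_completion) (simp add: borel_measurable_continuous_onI)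
    moreover have "(\<lambda>x. indicator \<Omega> x *\<^sub>R f x) \<in> borel_measurable lebesgue"
      using f by (simp add: in_L2_def set_borel_measurable_def)
    ultimately have "(\<lambda>x. (indicator \<Omega> x *\<^sub>R f x) * w x) \<in> borel_measurable lebesgue" by (rule borel_measurable_times[rotated])
    then show ?thesis by (simp add: set_borel_measurable_def mult.assoc)
  qed
  moreover have "norm (f x * w x) \<le> norm (M * (1 + (f x)\<^sup>2))" if "x \<in> \<Omega>" for x
  proof -
    have "2 * \<bar>f x\<bar> \<le> 1 + (f x)\<^sup>2" using sum_squares_bound[of 1 "\<bar>f x\<bar>"] by simp
    then have fb: "\<bar>f x\<bar> \<le> 1 + (f x)\<^sup>2" by linarith
    have M0: "0 \<le> M" using M[OF that] by linarith
    have "\<bar>f x\<bar> * \<bar>w x\<bar> \<le> (1 + (f x)\<^sup>2) * M"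
      using fb M[OF that] by (intro mult_mono) auto
    also have "\<dots> = norm (M * (1 + (f x)\<^sup>2))" using M0 by (simp add: abs_mult mult.commute)
    finally show ?thesis by (simp add: abs_mult)
  qed
  ultimately show ?thesis by (rule set_integrable_bound[OF _ _ AE_I2[OF impI]])
qed

lemma off_skeleton: "x \<in> \<Omega> - (closure \<Omega> - (\<Union>K\<in>\<T>. interior K)) \<Longrightarrow> x \<in> (\<Union>K\<in>\<T>. interior K)"
  using closure_subset by blast

lemma energy_add_left:
  assumes "u \<in> fe_space \<Omega> \<T>" "v \<in> fe_space \<Omega> \<T>" "w \<in> fe_space \<Omega> \<T>"
  shows "energy \<Omega> (\<lambda>x. u x + v x) w = energy \<Omega> u w + energy \<Omega> v w"
proof -
  have "energy \<Omega> (\<lambda>x. u x + v x) w = (LINT x:\<Omega>|lebesgue. grad u x \<bullet> grad w x + grad v x \<bullet> grad w x)"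
    unfolding energy_def
  proof (rule set_integral_spike(2)[OF _ negligible_skeleton])
    show "set_integrable lebesgue \<Omega> (\<lambda>x. grad u x \<bullet> grad w x + grad v x \<bullet> grad w x)"
      using assms by (intro set_integral_add(1) integrable_grad_inner)
    show "grad (\<lambda>x. u x + v x) x \<bullet> grad w x = grad u x \<bullet> grad w x + grad v x \<bullet> grad w x"
      if "x \<in> \<Omega> - (closure \<Omega> - (\<Union>K\<in>\<T>. interior K))" for x
      by (simp only: grad_add[OF assms(1,2) off_skeleton[OF that]] inner_add_left)
  qed
  also have "\<dots> = energy \<Omega> u w + energy \<Omega> v w"
    unfolding energy_def using assms by (intro set_integral_add(2) integrable_grad_inner)
  finally show ?thesis .
qed

lemma energy_scale_left:
  assumes "v \<in> fe_space \<Omega> \<T>" "w \<in> fe_space \<Omega> \<T>"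
  shows "energy \<Omega> (\<lambda>x. a * v x) w = a * energy \<Omega> v w"
proof -
  have "energy \<Omega> (\<lambda>x. a * v x) w = (LINT x:\<Omega>|lebesgue. a * (grad v x \<bullet> grad w x))"
    unfolding energy_def
  proof (rule set_integral_spike(2)[OF _ negligible_skeleton])
    show "set_integrable lebesgue \<Omega> (\<lambda>x. a * (grad v x \<bullet> grad w x))"
      using assms by (intro set_integrable_mult_right integrable_grad_inner)
    show "grad (\<lambda>x. a * v x) x \<bullet> grad w x = a * (grad v x \<bullet> grad w x)"
      if "x \<in> \<Omega> - (closure \<Omega> - (\<Union>K\<in>\<T>. interior K))" for x
      by (simp only: grad_scale[OF assms(1) off_skeleton[OF that]] inner_scaleR_left)
  qed
  then show ?thesis by (simp add: energy_def)
qed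

lemma energy_sum_left:
  assumes "\<And>i. i \<in> I \<Longrightarrow> v i \<in> fe_space \<Omega> \<T>" "w \<in> fe_space \<Omega> \<T>"
  shows "energy \<Omega> (\<lambda>x. \<Sum>i\<in>I. v i x) w = (\<Sum>i\<in>I. energy \<Omega> (v i) w)"
proof -
  have 0: "energy \<Omega> (\<lambda>x. 0) w = 0"
    using energy_scale_left[OF fe_space_0 assms(2), of 0] by simp
  show ?thesis using assms(1)
  proof (induction I rule: infinite_finite_induct)
    case (insert i I)
    then have "energy \<Omega> (\<lambda>x. v i x + (\<Sum>i\<in>I. v i x)) w = energy \<Omega> (v i) w + energy \<Omega> (\<lambda>x. \<Sum>i\<in>I. v i x) w"
      using assms(2) by (intro energy_add_left fe_space_sum) auto
    then show ?case using insert by simp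
  qed (simp_all add: 0)
qed

lemma energy_diff_left:
  assumes "u \<in> fe_space \<Omega> \<T>" "v \<in> fe_space \<Omega> \<T>" "w \<in> fe_space \<Omega> \<T>"
  shows "energy \<Omega> (\<lambda>x. u x - v x) w = energy \<Omega> u w - energy \<Omega> v w"
  using energy_add_left[OF assms(1) fe_space_scale[OF assms(2), of "-1"] assms(3)]
    energy_scale_left[OF assms(2,3), of "-1"] by simp

lemma energy_expand:
  assumes v: "v \<in> fe_space \<Omega> \<T>" and w: "w \<in> fe_space \<Omega> \<T>"
  shows "energy \<Omega> (\<lambda>x. v x - t * w x) (\<lambda>x. v x - t * w x) =
    energy \<Omega> v v - 2 * t * energy \<Omega> v w + t\<^sup>2 * energy \<Omega> w w"
proof -
  have tw: "(\<lambda>x. t * w x) \<in> fe_space \<Omega> \<T>" by (rule fe_space_scale[OF w])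
  note d = fe_space_diff[OF v tw]
  have "energy \<Omega> (\<lambda>x. v x - t * w x) y = energy \<Omega> v y - t * energy \<Omega> w y" if "y \<in> fe_space \<Omega> \<T>" for y
    using energy_diff_left[OF v tw that] energy_scale_left[OF w that] by simp
  from this[OF d] this[OF v] this[OF w] show ?thesis
    using energy_sym[of _ v "\<lambda>x. v x - t * w x"] energy_sym[of _ w "\<lambda>x. v x - t * w x"] energy_sym[of _ w v]
    by (simp add: power2_eq_square algebra_simps)
qed

text \<open>A function with zero gradient is constant on each element, so it is a continuous function on the whole space with finite range, hence constant, and it vanishes
  somewhere because \<open>\<Omega>\<close> is bounded.\<close>

lemma energy_definite:
  assumes w: "w \<in> fe_space \<Omega> \<T>" and 0: "energy \<Omega> w w = 0"
  shows "w = (\<lambda>x. 0)"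
proof -
  have "AE x in lebesgue. indicator \<Omega> x *\<^sub>R (grad w x \<bullet> grad w x) = 0"
    using 0 integrable_grad_inner[OF w w] unfolding energy_def set_lebesgue_integral_def set_integrable_def
    by (subst (asm) integral_nonneg_eq_0_iff_AE) auto
  then obtain N where N: "N \<in> null_sets lebesgue"
    "{x. indicator \<Omega> x *\<^sub>R (grad w x \<bullet> grad w x) \<noteq> (0::real)} \<subseteq> N"
    by (auto simp: eventually_ae_filter)
  have const: "\<exists>b. \<forall>x\<in>K. w x = b" if K: "K \<in> \<T>" for K
  proof -
    obtain g b where g: "\<forall>x\<in>K. w x = g \<bullet> x + b" "\<forall>x\<in>interior K. GDERIV w x :> g"
      "\<forall>x\<in>interior K. grad w x = g" by (rule fe_function_on_element[OF w K])
    obtain C where C: "\<not> affine_dependent C" "int (card C) = int DIM('a) + 1" "K = convex hull C"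
      using matching_meshD(3)[OF mesh K] by (auto simp: simplex)
    then have ne: "interior K \<noteq> {}" using interior_convex_hull_eq_empty[of C] by simp
    have "g = 0"
    proof (rule ccontr)
      assume "g \<noteq> 0"
      then have "interior K \<subseteq> N" using N(2) g(3) interior_elements_subset K by fastforce
      then have "negligible (interior K)"
        using N(1) negligible_iff_null_sets negligible_subset by blast
      then show False using ne open_not_negligible[OF open_interior] by blast
    qed
    then show ?thesis using g(1) by (intro exI[of _ b]) simp
  qed
  then have "\<forall>K\<in>\<T>. \<exists>b. \<forall>x\<in>K. w x = b" by (rule ballI)
  from bchoice[OF this] obtain b where b: "\<forall>K\<in>\<T>. \<forall>x\<in>K. w x = b K" ..
  have "range w \<subseteq> insert 0 (b ` \<T>)"
  proof
    fix y assume "y \<in> range w"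
    then obtain x where x: "y = w x" by blast
    show "y \<in> insert 0 (b ` \<T>)"
    proof (cases "x \<in> closure \<Omega>")
      case True
      then obtain K where "K \<in> \<T>" "x \<in> K" using matching_meshD(2)[OF mesh] by blast
      then show ?thesis using b x by simp
    next
      case False
      then have "x \<notin> \<Omega>" using closure_subset by blast
      then show ?thesis using w x by (simp add: fe_space_def)
    qed
  qed
  then have "finite (range w)" by (rule finite_subset) (use matching_meshD(1)[OF mesh] in simp)
  then have "w constant_on UNIV"
    by (intro continuous_finite_range_constant fe_continuous[OF w]) auto
  then obtain c where c: "\<And>x. w x = c" by (auto simp: constant_on_def)
  obtain y where "y \<notin> \<Omega>" using bounded_domain not_bounded_UNIV by (metis UNIV_eq_I)
  then have "c = 0" using c[of y] w by (simp add: fe_space_def)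
  then show ?thesis using c by auto
qed

lemma residual_eq:
  assumes f: "in_L2 \<Omega> f" and v: "v \<in> fe_space \<Omega> \<T>" and w: "w \<in> fe_space \<Omega> \<T>"
  shows "residual \<Omega> f v w = (LINT x:\<Omega>|lebesgue. f x * w x) - energy \<Omega> v w"
  unfolding residual_def energy_def
  by (rule set_integral_diff(2)[OF integrable_load[OF f w] integrable_grad_inner[OF v w]])

text \<open>Galerkin orthogonality, stated as: on the discrete space the residual is represented by the
  discrete error. In particular it is linear there.\<close>

lemma residual_galerkin:
  assumes f: "in_L2 \<Omega> f" and v: "v \<in> fe_space \<Omega> \<T>" and w: "w \<in> fe_space \<Omega> \<T>"
    and u: "galerkin_solution \<Omega> \<T> f u"
  shows "residual \<Omega> f v w = energy \<Omega> (\<lambda>x. u x - v x) w"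
proof -
  have "u \<in> fe_space \<Omega> \<T>" "energy \<Omega> u w = (LINT x:\<Omega>|lebesgue. f x * w x)"
    using u w by (simp_all add: galerkin_solution_def energy_def)
  then show ?thesis using residual_eq[OF f v w] energy_diff_left[of u v w] v w by simp
qed

end

section \<open>Positive definite matrices and conjugate gradients\<close>

lemma spd_matrixD:
  assumes "spd_matrix n M"
  shows "M \<in> carrier_mat n n"
    and "\<And>x y. x \<in> carrier_vec n \<Longrightarrow> y \<in> carrier_vec n \<Longrightarrow>
      Matrix.scalar_prod x (M *\<^sub>v y) = Matrix.scalar_prod y (M *\<^sub>v x)"
    and "\<And>x. x \<in> carrier_vec n \<Longrightarrow> 0 \<le> quad_form M x"
proof -
  show M: "M \<in> carrier_mat n n" using assms by (simp add: spd_matrix_def)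
  have sym: "transpose_mat M = M" using assms by (simp add: spd_matrix_def)
  show "Matrix.scalar_prod x (M *\<^sub>v y) = Matrix.scalar_prod y (M *\<^sub>v x)"
    if "x \<in> carrier_vec n" "y \<in> carrier_vec n" for x y
  proof -
    have "Matrix.scalar_prod x (M *\<^sub>v y) = Matrix.scalar_prod (M *\<^sub>v x) y"
      using transpose_vec_mult_scalar[OF M that(2,1)] sym by simp
    also have "\<dots> = Matrix.scalar_prod y (M *\<^sub>v x)"
      by (rule comm_scalar_prod[of _ n]) (use M that in auto)
    finally show ?thesis .
  qed
  show "0 \<le> quad_form M x" if x: "x \<in> carrier_vec n" for x
  proof (cases "x = 0\<^sub>v n")
    case True
    have "M *\<^sub>v 0\<^sub>v n \<in> carrier_vec n" using M by auto
    then show ?thesis using True by (simp add: quad_form_def)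
  next
    case False
    then show ?thesis using assms x by (auto simp: spd_matrix_def intro: less_imp_le)
  qed
qed

lemma quad_form_expand:
  assumes M: "spd_matrix n M" and x: "x \<in> carrier_vec n" and y: "y \<in> carrier_vec n"
  shows "quad_form M (x - t \<cdot>\<^sub>v y) =
    quad_form M x - 2 * t * Matrix.scalar_prod x (M *\<^sub>v y) + t\<^sup>2 * quad_form M y"
proof -
  note MD = spd_matrixD[OF M]
  have c: "M *\<^sub>v x \<in> carrier_vec n" "M *\<^sub>v y \<in> carrier_vec n" "t \<cdot>\<^sub>v y \<in> carrier_vec n"
    using MD(1) x y by auto
  have "M *\<^sub>v (x - t \<cdot>\<^sub>v y) = M *\<^sub>v x - t \<cdot>\<^sub>v (M *\<^sub>v y)"
    using mult_minus_distrib_mat_vec[OF MD(1) x c(3)] mult_mat_vec[OF MD(1) y] by simp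
  then have "quad_form M (x - t \<cdot>\<^sub>v y) =
      Matrix.scalar_prod x (M *\<^sub>v x) - t * Matrix.scalar_prod x (M *\<^sub>v y)
      - t * (Matrix.scalar_prod y (M *\<^sub>v x) - t * Matrix.scalar_prod y (M *\<^sub>v y))"
    unfolding quad_form_def using x y c
    by (simp add: minus_scalar_prod_distrib[of _ n] scalar_prod_minus_distrib[of _ n]
        right_diff_distrib)
  also have "\<dots> = quad_form M x - 2 * t * Matrix.scalar_prod x (M *\<^sub>v y) + t\<^sup>2 * quad_form M y"
    unfolding quad_form_def using MD(2)[OF x y] by (simp add: power2_eq_square algebra_simps)
  finally show ?thesis .
qed

lemma spd_mat_inv:
  assumes "spd_matrix n M"
  shows "mat_inv M \<in> carrier_mat n n" "M * mat_inv M = 1\<^sub>m n"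
proof -
  have M: "M \<in> carrier_mat n n" using assms by (simp add: spd_matrix_def)
  have "det M \<noteq> 0"
  proof
    assume "det M = 0"
    then obtain v where v: "v \<in> carrier_vec n" "v \<noteq> 0\<^sub>v n" "M *\<^sub>v v = 0\<^sub>v n"
      using det_0_iff_vec_prod_zero[OF M] by blast
    then have "quad_form M v = 0" by (simp add: quad_form_def)
    moreover have "0 < quad_form M v" using assms v by (simp add: spd_matrix_def)
    ultimately show False by simp
  qed
  then have "M \<in> Units (ring_mat TYPE(real) n ())" by (rule det_non_zero_imp_unit[OF M])
  then obtain B where "mat_inverse M = Some B"
    using mat_inverse(1)[OF M, of "()"] by (cases "mat_inverse M") auto
  then show "mat_inv M \<in> carrier_mat n n" "M * mat_inv M = 1\<^sub>m n"
    using mat_inverse(2)[OF M] by (auto simp: mat_inv_def)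
qed

lemma mat_inv_solves:
  assumes M: "spd_matrix n M" and r: "r \<in> carrier_vec n"
  shows "mat_inv M *\<^sub>v r \<in> carrier_vec n" "M *\<^sub>v (mat_inv M *\<^sub>v r) = r"
    "quad_form M (mat_inv M *\<^sub>v r) = quad_form (mat_inv M) r"
proof -
  note inv = spd_mat_inv[OF M]
  show c: "mat_inv M *\<^sub>v r \<in> carrier_vec n" using inv(1) r by simp
  show eq: "M *\<^sub>v (mat_inv M *\<^sub>v r) = r"
    using assoc_mult_mat_vec[OF spd_matrixD(1)[OF M] inv(1) r] inv(2) r by simp
  show "quad_form M (mat_inv M *\<^sub>v r) = quad_form (mat_inv M) r"
    unfolding quad_form_def eq by (rule comm_scalar_prod[OF c r])
qed

text \<open>Cauchy--Schwarz for the dual pair of norms given by \<open>M\<close> and its inverse, with the free parameter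
  \<open>s\<close> of Young's inequality. This form adds up over several matrices without square roots.\<close>

lemma young_spd:
  assumes M: "spd_matrix n M" and c: "c \<in> carrier_vec n" and r: "r \<in> carrier_vec n"
  shows "2 * s * Matrix.scalar_prod c r \<le> s\<^sup>2 * quad_form M c + quad_form (mat_inv M) r"
proof -
  note y = mat_inv_solves[OF M r]
  have "0 \<le> quad_form M (mat_inv M *\<^sub>v r - s \<cdot>\<^sub>v c)"
    using y(1) c by (intro spd_matrixD(3)[OF M]) simp
  also have "\<dots> = quad_form M (mat_inv M *\<^sub>v r) - 2 * s * Matrix.scalar_prod (mat_inv M *\<^sub>v r) (M *\<^sub>v c) + s\<^sup>2 * quad_form M c"
    by (rule quad_form_expand[OF M y(1) c])
  also have "Matrix.scalar_prod (mat_inv M *\<^sub>v r) (M *\<^sub>v c) = Matrix.scalar_prod c r"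
    using spd_matrixD(2)[OF M y(1) c] y(2) by simp
  finally show ?thesis using y(3) by simp
qed

lemma krylov_space_subspace:
  assumes P: "spd_matrix n P" and A: "A \<in> carrier_mat n n" and r: "r \<in> carrier_vec n"
  shows "krylov_space n P A r m \<subseteq> carrier_vec n"
    and "x \<in> krylov_space n P A r m \<Longrightarrow> y \<in> krylov_space n P A r m \<Longrightarrow>
      x + a \<cdot>\<^sub>v y \<in> krylov_space n P A r m"
    and "krylov_space n P A r m \<subseteq> krylov_space n P A r (Suc m)"
    and "krylov_space n P A r 0 = {0\<^sub>v n}"
proof -
  interpret vec_space "TYPE(real)" n .
  let ?S = "\<lambda>m. {((mat_inv P * A) ^\<^sub>m k) *\<^sub>v (mat_inv P *\<^sub>v r) |k. k < m}"
  have S: "?S m \<subseteq> carrier_vec n" for m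
  proof -
    have "(mat_inv P * A) ^\<^sub>m k \<in> carrier_mat n n" for k
      using spd_mat_inv(1)[OF P] A by (intro pow_carrier_mat mult_carrier_mat)
    moreover have "mat_inv P *\<^sub>v r \<in> carrier_vec n" using spd_mat_inv(1)[OF P] r by simp
    ultimately have "(mat_inv P * A) ^\<^sub>m k *\<^sub>v (mat_inv P *\<^sub>v r) \<in> carrier_vec n" for k
      by (rule mult_mat_vec_carrier)
    then show ?thesis by blast
  qed
  show "krylov_space n P A r m \<subseteq> carrier_vec n"
    unfolding krylov_space_def using span_is_subset2[OF S] by simp
  show "x + a \<cdot>\<^sub>v y \<in> krylov_space n P A r m"
    if "x \<in> krylov_space n P A r m" "y \<in> krylov_space n P A r m"
  proof -
    have sub: "submodule class_ring (span (?S m)) V" by (rule span_is_submodule) (use S in simp)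
    show ?thesis
      using submodule.m_closed[OF sub _ submodule.smult_closed[OF sub]] that
      unfolding krylov_space_def by (simp add: module_vec_simps class_ring_simps)
  qed
  show "krylov_space n P A r m \<subseteq> krylov_space n P A r (Suc m)"
    unfolding krylov_space_def by (rule span_is_monotone) auto
  show "krylov_space n P A r 0 = {0\<^sub>v n}"
    unfolding krylov_space_def using span_empty by (simp add: module_vec_simps)
qed

text \<open>Optimality makes the error of each iterate orthogonal to its Krylov space. The Krylov spaces are
  nested, so the error after a step is orthogonal to that step, and Pythagoras gives a telescoping
  sum that starts at the exact solution, because the initial guess is zero.\<close>

lemma pcg_energy_identity:
  assumes A: "spd_matrix n A" and P: "spd_matrix n P" and r: "r \<in> carrier_vec n"
    and pcg: "pcg_iterates n P A r c"
  shows "quad_form (mat_inv A) r =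
    (\<Sum>m<i. (energy_norm A (c (Suc m) - c m))\<^sup>2) + (energy_norm A (mat_inv A *\<^sub>v r - c i))\<^sup>2"
proof -
  note AD = spd_matrixD[OF A]
  note sol = mat_inv_solves[OF A r]
  note K = krylov_space_subspace[OF P AD(1) r]
  let ?x = "mat_inv A *\<^sub>v r"
  let ?K = "krylov_space n P A r"
  have cK: "c m \<in> ?K m" for m using pcg by (auto simp: pcg_iterates_def is_arg_min_def)
  then have cc: "c m \<in> carrier_vec n" for m using K(1) by blast
  have sq: "(energy_norm A v)\<^sup>2 = quad_form A v" if "v \<in> carrier_vec n" for v
    using AD(3)[OF that] by (simp add: energy_norm_def)
  have opt: "quad_form A (?x - c m) \<le> quad_form A (?x - y)" if "y \<in> ?K m" for m y
    using pcg that by (auto simp: pcg_iterates_def is_arg_min_def energy_norm_def not_less)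
  have orth: "Matrix.scalar_prod (?x - c m) (A *\<^sub>v y) = 0" if y: "y \<in> ?K m" for m y
  proof -
    have yc: "y \<in> carrier_vec n" using y K(1) by blast
    have e: "?x - c m \<in> carrier_vec n" using sol(1) cc by simp
    let ?b = "Matrix.scalar_prod (?x - c m) (A *\<^sub>v y)"
    have ineq: "0 \<le> - 2 * t * ?b + t\<^sup>2 * quad_form A y" for t
    proof -
      have "?x - (c m + t \<cdot>\<^sub>v y) = ?x - c m - t \<cdot>\<^sub>v y"
        using sol(1) cc[of m] yc by (intro eq_vecI) auto
      then show ?thesis
        using opt[OF K(2)[OF cK y], of t] quad_form_expand[OF A e yc, of t] by simp
    qed
    show ?thesis
    proof (cases "quad_form A y = 0")
      case True
      then show ?thesis using ineq[of 1] ineq[of "-1"] by simp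
    next
      case False
      then have q: "quad_form A y > 0" using AD(3)[OF yc] by simp
      have "0 \<le> - (?b * ?b / quad_form A y)"
        using ineq[of "?b / quad_form A y"] q by (simp add: power2_eq_square field_simps)
      then have "?b * ?b \<le> 0" using q by (simp add: divide_le_0_iff)
      then show ?thesis by (auto simp: mult_le_0_iff)
    qed
  qed
  have step: "quad_form A (?x - c m) = quad_form A (c (Suc m) - c m) + quad_form A (?x - c (Suc m))" for m
  proof -
    let ?d = "c (Suc m) - c m"
    have e: "?x - c (Suc m) \<in> carrier_vec n" and d: "?d \<in> carrier_vec n" using sol(1) cc by simp_all
    have "?d = c (Suc m) + (-1) \<cdot>\<^sub>v c m" using cc[of m] cc[of "Suc m"] by (intro eq_vecI) auto
    moreover have "c m \<in> ?K (Suc m)" using cK K(3) by blast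
    ultimately have "?d \<in> ?K (Suc m)" using K(2)[OF cK] by simp
    moreover have "?x - c m = ?x - c (Suc m) - (-1) \<cdot>\<^sub>v ?d"
      using sol(1) cc[of m] cc[of "Suc m"] by (intro eq_vecI) auto
    ultimately show ?thesis using quad_form_expand[OF A e d, of "-1"] orth by simp
  qed
  have "quad_form A (?x - c 0) = (\<Sum>m<i. quad_form A (c (Suc m) - c m)) + quad_form A (?x - c i)"
  proof (induction i)
    case (Suc i)
    then show ?case using step[of i] by simp
  qed simp
  moreover have "?x - c 0 = ?x"
  proof -
    have "c 0 = 0\<^sub>v n" using cK[of 0] K(4) by simp
    then show ?thesis using sol(1) by simp
  qed
  moreover have "(energy_norm A (c (Suc m) - c m))\<^sup>2 = quad_form A (c (Suc m) - c m)" for m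
    using cc by (intro sq) simp
  moreover have "(energy_norm A (?x - c i))\<^sup>2 = quad_form A (?x - c i)"
    using cc sol(1) by (intro sq) simp
  ultimately show ?thesis using sol(3) by simp
qed

section \<open>Coefficient vectors and matrices of a mesh\<close>

definition fe_function ::
    "'a::euclidean_space set \<Rightarrow> 'a set set \<Rightarrow> (nat \<Rightarrow> 'a) \<Rightarrow> real Matrix.vec \<Rightarrow> 'a \<Rightarrow> real" where
  "fe_function \<Omega> \<T> p c = (\<lambda>x. \<Sum>m<card (free_nodes \<Omega> \<T>). Matrix.vec_index c m * hat \<Omega> \<T> (p m) x)"

locale enumerated_fe_mesh = fe_mesh \<Omega> \<T> for \<Omega> :: "'a::euclidean_space set" and \<T> +
  fixes p :: "nat \<Rightarrow> 'a"
  assumes nodes: "enumerates p (free_nodes \<Omega> \<T>)"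
begin

abbreviation (input) "n \<equiv> card (free_nodes \<Omega> \<T>)"

lemma node_bij: "bij_betw p {..<n} (free_nodes \<Omega> \<T>)"
  using nodes by (simp add: enumerates_def)

lemma node: "m < n \<Longrightarrow> p m \<in> free_nodes \<Omega> \<T>"
  using node_bij by (auto simp: bij_betw_def)

lemma node_eq_iff: "m < n \<Longrightarrow> k < n \<Longrightarrow> p m = p k \<longleftrightarrow> m = k"
  using node_bij by (auto simp: bij_betw_def inj_on_def)

lemma hat_node: "m < n \<Longrightarrow> hat \<Omega> \<T> (p m) \<in> fe_space \<Omega> \<T>"
  using hat_properties(1)[OF domain mesh node] .

lemma scaled_hat_node: "m < n \<Longrightarrow> (\<lambda>x. a * hat \<Omega> \<T> (p m) x) \<in> fe_space \<Omega> \<T>"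
  by (intro fe_space_scale hat_node)

lemma fe_function_in_space: "fe_function \<Omega> \<T> p c \<in> fe_space \<Omega> \<T>"
  unfolding fe_function_def by (intro fe_space_sum scaled_hat_node) simp

lemma fe_function_at_node:
  assumes "m < n"
  shows "fe_function \<Omega> \<T> p c (p m) = Matrix.vec_index c m"
proof -
  have "fe_function \<Omega> \<T> p c (p m) = (\<Sum>k<n. if k = m then Matrix.vec_index c k else 0)"
    unfolding fe_function_def
    using hat_properties(2)[OF domain mesh node node[OF assms]] node_eq_iff assms
    by (intro sum.cong) auto
  then show ?thesis using assms by simp
qed

lemma fe_function_nodal_values:
  assumes "w \<in> fe_space \<Omega> \<T>"
  shows "fe_function \<Omega> \<T> p (Matrix.vec n (\<lambda>m. w (p m))) = w"
proof -
  have "fe_function \<Omega> \<T> p (Matrix.vec n (\<lambda>m. w (p m))) x = (\<Sum>z\<in>free_nodes \<Omega> \<T>. w z * hat \<Omega> \<T> z x)" for x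
    unfolding fe_function_def
    by (subst sum.reindex_bij_betw[OF node_bij, symmetric]) (intro sum.cong, auto)
  then have "fe_function \<Omega> \<T> p (Matrix.vec n (\<lambda>m. w (p m))) = (\<lambda>x. \<Sum>z\<in>free_nodes \<Omega> \<T>. w z * hat \<Omega> \<T> z x)"
    by (rule ext)
  also have "\<dots> = w" by (rule fe_space_nodal_expansion[OF domain mesh assms, symmetric])
  finally show ?thesis .
qed

lemma energy_scaled_hat:
  assumes "m < n"
  shows "energy \<Omega> (\<lambda>x. a * hat \<Omega> \<T> (p m) x) (\<lambda>x. a * hat \<Omega> \<T> (p m) x)
    = a\<^sup>2 * energy \<Omega> (hat \<Omega> \<T> (p m)) (hat \<Omega> \<T> (p m))"
proof -
  let ?h = "hat \<Omega> \<T> (p m)"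
  have "energy \<Omega> (\<lambda>x. a * ?h x) (\<lambda>x. a * ?h x) = a * energy \<Omega> ?h (\<lambda>x. a * ?h x)"
    by (intro energy_scale_left hat_node scaled_hat_node assms)
  also have "energy \<Omega> ?h (\<lambda>x. a * ?h x) = energy \<Omega> (\<lambda>x. a * ?h x) ?h" by (rule energy_sym)
  also have "\<dots> = a * energy \<Omega> ?h ?h" by (intro energy_scale_left hat_node assms)
  finally show ?thesis by (simp add: power2_eq_square)
qed

lemma energy_fe_function:
  assumes w: "w \<in> fe_space \<Omega> \<T>"
  shows "energy \<Omega> (fe_function \<Omega> \<T> p c) w = (\<Sum>m<n. Matrix.vec_index c m * energy \<Omega> (hat \<Omega> \<T> (p m)) w)"
proof -
  have "energy \<Omega> (fe_function \<Omega> \<T> p c) w = (\<Sum>m<n. energy \<Omega> (\<lambda>x. Matrix.vec_index c m * hat \<Omega> \<T> (p m) x) w)"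
    unfolding fe_function_def by (intro energy_sum_left scaled_hat_node w) simp
  also have "\<dots> = (\<Sum>m<n. Matrix.vec_index c m * energy \<Omega> (hat \<Omega> \<T> (p m)) w)"
    by (intro sum.cong refl energy_scale_left hat_node w) simp
  finally show ?thesis .
qed

lemma quad_form_stiffness:
  assumes c: "c \<in> carrier_vec n"
  shows "quad_form (stiffness_matrix \<Omega> \<T> p) c = energy \<Omega> (fe_function \<Omega> \<T> p c) (fe_function \<Omega> \<T> p c)"
proof -
  have "energy \<Omega> (hat \<Omega> \<T> (p m)) (fe_function \<Omega> \<T> p c)
      = Matrix.vec_index (stiffness_matrix \<Omega> \<T> p *\<^sub>v c) m" if m: "m < n" for m
  proof -
    have "energy \<Omega> (hat \<Omega> \<T> (p m)) (fe_function \<Omega> \<T> p c)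
        = (\<Sum>k<n. Matrix.vec_index c k * energy \<Omega> (hat \<Omega> \<T> (p k)) (hat \<Omega> \<T> (p m)))"
      by (subst energy_sym) (rule energy_fe_function[OF hat_node[OF m]])
    also have "\<dots> = Matrix.vec_index (stiffness_matrix \<Omega> \<T> p *\<^sub>v c) m"
      using m c by (simp add: stiffness_matrix_def energy_def scalar_prod_def atLeast0LessThan mult.commute)
    finally show ?thesis .
  qed
  then have "energy \<Omega> (fe_function \<Omega> \<T> p c) (fe_function \<Omega> \<T> p c)
      = (\<Sum>m<n. Matrix.vec_index c m * Matrix.vec_index (stiffness_matrix \<Omega> \<T> p *\<^sub>v c) m)"
    unfolding energy_fe_function[OF fe_function_in_space] by (intro sum.cong) auto
  also have "\<dots> = quad_form (stiffness_matrix \<Omega> \<T> p) c"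
    by (simp add: quad_form_def scalar_prod_def stiffness_matrix_def atLeast0LessThan)
  finally show ?thesis by (rule sym)
qed

lemma quad_form_diagonal:
  assumes c: "c \<in> carrier_vec n"
  shows "quad_form (stiffness_diagonal \<Omega> \<T> p) c =
    (\<Sum>m<n. (Matrix.vec_index c m)\<^sup>2 * energy \<Omega> (hat \<Omega> \<T> (p m)) (hat \<Omega> \<T> (p m)))"
proof -
  have row: "Matrix.vec_index (stiffness_diagonal \<Omega> \<T> p *\<^sub>v c) m
      = energy \<Omega> (hat \<Omega> \<T> (p m)) (hat \<Omega> \<T> (p m)) * Matrix.vec_index c m" if "m < n" for m
  proof -
    have "Matrix.vec_index (stiffness_diagonal \<Omega> \<T> p *\<^sub>v c) m
       = (\<Sum>k<n. (if m = k then energy \<Omega> (hat \<Omega> \<T> (p k)) (hat \<Omega> \<T> (p k)) else 0) * Matrix.vec_index c k)"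
      using that c
      by (simp add: stiffness_diagonal_def mat_diag_def energy_def scalar_prod_def atLeast0LessThan cong: if_cong)
    also have "\<dots> = (\<Sum>k<n. if m = k then energy \<Omega> (hat \<Omega> \<T> (p k)) (hat \<Omega> \<T> (p k)) * Matrix.vec_index c k else 0)"
      by (intro sum.cong) auto
    finally show ?thesis using that by simp
  qed
  have "quad_form (stiffness_diagonal \<Omega> \<T> p) c
      = (\<Sum>m<n. Matrix.vec_index c m * Matrix.vec_index (stiffness_diagonal \<Omega> \<T> p *\<^sub>v c) m)"
    by (simp add: quad_form_def scalar_prod_def stiffness_diagonal_def mat_diag_def atLeast0LessThan)
  also have "\<dots> = (\<Sum>m<n. (Matrix.vec_index c m)\<^sup>2 * energy \<Omega> (hat \<Omega> \<T> (p m)) (hat \<Omega> \<T> (p m)))"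
    by (intro sum.cong refl) (simp only: row lessThan_iff power2_eq_square ac_simps)
  finally show ?thesis .
qed

lemma energy_hat_pos:
  assumes "m < n"
  shows "0 < energy \<Omega> (hat \<Omega> \<T> (p m)) (hat \<Omega> \<T> (p m))"
proof -
  have "hat \<Omega> \<T> (p m) (p m) = 1" using hat_properties(2)[OF domain mesh node node] assms by simp
  then have "energy \<Omega> (hat \<Omega> \<T> (p m)) (hat \<Omega> \<T> (p m)) \<noteq> 0"
    using energy_definite[OF hat_node[OF assms]] by auto
  then show ?thesis using energy_nonneg by (simp add: less_le)
qed

text \<open>Definiteness of the energy transfers to the matrix because the coefficients are nodal values, so
  that a nonzero vector gives a nonzero function.\<close>

lemma spd_stiffness: "spd_matrix n (stiffness_matrix \<Omega> \<T> p)"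
  unfolding spd_matrix_def
proof (intro conjI ballI impI)
  show "stiffness_matrix \<Omega> \<T> p \<in> carrier_mat n n" by (simp add: stiffness_matrix_def)
  show "transpose_mat (stiffness_matrix \<Omega> \<T> p) = stiffness_matrix \<Omega> \<T> p"
    by (intro eq_matI) (auto simp: stiffness_matrix_def inner_commute)
  fix c :: "real Matrix.vec" assume c: "c \<in> carrier_vec n" "c \<noteq> 0\<^sub>v n"
  have "energy \<Omega> (fe_function \<Omega> \<T> p c) (fe_function \<Omega> \<T> p c) \<noteq> 0"
  proof
    assume "energy \<Omega> (fe_function \<Omega> \<T> p c) (fe_function \<Omega> \<T> p c) = 0"
    then have z: "fe_function \<Omega> \<T> p c = (\<lambda>x. 0)" by (rule energy_definite[OF fe_function_in_space])
    have "Matrix.vec_index c m = 0" if "m < n" for m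
      using fe_function_at_node[OF that, of c] z by simp
    then have "c = 0\<^sub>v n" using c(1) by (intro eq_vecI) auto
    then show False using c(2) by simp
  qed
  then show "0 < quad_form (stiffness_matrix \<Omega> \<T> p) c"
    unfolding quad_form_stiffness[OF c(1)] using energy_nonneg[of \<Omega> "fe_function \<Omega> \<T> p c"] by linarith
qed

lemma spd_diagonal: "spd_matrix n (stiffness_diagonal \<Omega> \<T> p)"
  unfolding spd_matrix_def
proof (intro conjI ballI impI)
  show "stiffness_diagonal \<Omega> \<T> p \<in> carrier_mat n n" by (simp add: stiffness_diagonal_def)
  show "transpose_mat (stiffness_diagonal \<Omega> \<T> p) = stiffness_diagonal \<Omega> \<T> p"
    by (intro eq_matI) (auto simp: stiffness_diagonal_def mat_diag_def)
  fix c :: "real Matrix.vec" assume c: "c \<in> carrier_vec n" "c \<noteq> 0\<^sub>v n"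
  then obtain k where k: "k < n" "Matrix.vec_index c k \<noteq> 0" by (metis carrier_vecD eq_vecI index_zero_vec)
  show "0 < quad_form (stiffness_diagonal \<Omega> \<T> p) c"
    unfolding quad_form_diagonal[OF c(1)]
    by (rule sum_pos2[of _ k]) (use k energy_hat_pos in \<open>auto simp: energy_nonneg\<close>)
qed

lemma residual_vector_carrier: "residual_vector \<Omega> \<T> p f v \<in> carrier_vec n"
  by (simp add: residual_vector_def)

text \<open>The residual is formed with functions of a finer mesh \<open>\<T>\<^sub>f\<close> but tested with those of \<open>\<T>\<close>; the
  inclusion of the spaces makes Galerkin orthogonality available for these test functions.\<close>

lemma scalar_prod_residual_vector:
  assumes fine: "fe_mesh \<Omega> \<T>\<^sub>f" "fe_space \<Omega> \<T> \<subseteq> fe_space \<Omega> \<T>\<^sub>f"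
    and f: "in_L2 \<Omega> f" and v: "v \<in> fe_space \<Omega> \<T>\<^sub>f" and u: "galerkin_solution \<Omega> \<T>\<^sub>f f u"
  shows "Matrix.scalar_prod c (residual_vector \<Omega> \<T> p f v) = energy \<Omega> (fe_function \<Omega> \<T> p c) (\<lambda>x. u x - v x)"
proof -
  have e: "(\<lambda>x. u x - v x) \<in> fe_space \<Omega> \<T>\<^sub>f" using u v by (intro fe_space_diff) (auto simp: galerkin_solution_def)
  have h: "hat \<Omega> \<T> (p m) \<in> fe_space \<Omega> \<T>\<^sub>f" if "m < n" for m using hat_node[OF that] fine(2) by blast
  have "energy \<Omega> (fe_function \<Omega> \<T> p c) (\<lambda>x. u x - v x)
      = (\<Sum>m<n. energy \<Omega> (\<lambda>x. Matrix.vec_index c m * hat \<Omega> \<T> (p m) x) (\<lambda>x. u x - v x))"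
    unfolding fe_function_def
    by (intro fe_mesh.energy_sum_left[OF fine(1)] fe_space_scale h e) simp
  also have "\<dots> = (\<Sum>m<n. Matrix.vec_index c m * energy \<Omega> (hat \<Omega> \<T> (p m)) (\<lambda>x. u x - v x))"
    by (intro sum.cong refl fe_mesh.energy_scale_left[OF fine(1)] h e) simp
  also have "\<dots> = (\<Sum>m<n. Matrix.vec_index c m * residual \<Omega> f v (hat \<Omega> \<T> (p m)))"
  proof (intro sum.cong refl)
    fix m assume "m \<in> {..<n}"
    then have "residual \<Omega> f v (hat \<Omega> \<T> (p m)) = energy \<Omega> (\<lambda>x. u x - v x) (hat \<Omega> \<T> (p m))"
      by (intro fe_mesh.residual_galerkin[OF fine(1) f v h u]) simp
    then show "Matrix.vec_index c m * energy \<Omega> (hat \<Omega> \<T> (p m)) (\<lambda>x. u x - v x)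
        = Matrix.vec_index c m * residual \<Omega> f v (hat \<Omega> \<T> (p m))"
      by (simp only: energy_sym[of _ "hat \<Omega> \<T> (p m)" "\<lambda>x. u x - v x"])
  qed
  finally show ?thesis by (simp add: scalar_prod_def residual_vector_def atLeast0LessThan)
qed

text \<open>The diagonal matrix represents the sum of the energies of the basis components, so the stability
  of the basis is a spectral equivalence with the weighted norm.\<close>

lemma quad_form_diagonal_stable:
  assumes stable: "stable_basis cB CB \<Omega> \<T>s" and T: "\<T>s j = \<T>" and c: "c \<in> carrier_vec n"
  defines "H \<equiv> (L2_norm \<Omega> (\<lambda>x. inverse (mesh_size \<T> x) * fe_function \<Omega> \<T> p c x))\<^sup>2"
  shows "cB * H \<le> quad_form (stiffness_diagonal \<Omega> \<T> p) c" "quad_form (stiffness_diagonal \<Omega> \<T> p) c \<le> CB * H"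
proof -
  let ?w = "fe_function \<Omega> \<T> p c"
  let ?S = "\<Sum>z\<in>free_nodes \<Omega> \<T>. (L2_norm \<Omega> (grad (\<lambda>x. ?w z * hat \<Omega> \<T> z x)))\<^sup>2"
  have "?S = (\<Sum>m<n. (L2_norm \<Omega> (grad (\<lambda>x. ?w (p m) * hat \<Omega> \<T> (p m) x)))\<^sup>2)"
    by (rule sum.reindex_bij_betw[OF node_bij, symmetric])
  also have "\<dots> = quad_form (stiffness_diagonal \<Omega> \<T> p) c"
    unfolding quad_form_diagonal[OF c] energy_eq_L2_norm
    by (intro sum.cong refl) (simp add: fe_function_at_node energy_scaled_hat)
  finally have S: "?S = quad_form (stiffness_diagonal \<Omega> \<T> p) c" .
  have "?w = (\<lambda>x. \<Sum>z\<in>free_nodes \<Omega> \<T>. ?w z * hat \<Omega> \<T> z x)"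
    by (rule fe_space_nodal_expansion[OF domain mesh fe_function_in_space])
  then have "cB * H \<le> ?S \<and> ?S \<le> CB * H"
    using stable[unfolded stable_basis_def Let_def, THEN conjunct2, THEN conjunct2, rule_format, of ?w j ?w]
      fe_function_in_space unfolding T H_def by blast
  then show "cB * H \<le> quad_form (stiffness_diagonal \<Omega> \<T> p) c" "quad_form (stiffness_diagonal \<Omega> \<T> p) c \<le> CB * H"
    unfolding S by auto
qed

end

section \<open>Equivalence of the multilevel estimator and the error\<close>

locale multilevel_residual =
  fixes C\<^sub>3\<^sub>D :: real and \<Omega> :: "'a::euclidean_space set" and \<T> :: "nat \<Rightarrow> 'a set set"
    and p :: "nat \<Rightarrow> nat \<Rightarrow> 'a" and J :: nat and f u v :: "'a \<Rightarrow> real"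
  assumes hierarchy: "mesh_hierarchy C\<^sub>3\<^sub>D \<Omega> \<T>"
    and nodes: "\<And>j. enumerates (p j) (free_nodes \<Omega> (\<T> j))"
    and f: "in_L2 \<Omega> f" and v: "v \<in> fe_space \<Omega> (\<T> J)" and u: "galerkin_solution \<Omega> (\<T> J) f u"
begin

text \<open>The coarsest level is solved exactly, with the stiffness matrix, and the finer levels use only its
  diagonal. Both are symmetric positive definite, and the estimate treats all levels alike.\<close>

definition level_matrix :: "nat \<Rightarrow> real Matrix.mat" where
  "level_matrix j = (if j = 0 then stiffness_matrix \<Omega> (\<T> 0) (p 0) else stiffness_diagonal \<Omega> (\<T> j) (p j))"

definition level_residual :: "nat \<Rightarrow> real Matrix.vec" where
  "level_residual j = residual_vector \<Omega> (\<T> j) (p j) f v"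

definition estimator :: real where
  "estimator = (\<Sum>j\<le>J. quad_form (mat_inv (level_matrix j)) (level_residual j))"

text \<open>The contribution of level \<open>j\<close> to the splitting functional.\<close>

definition level_norm2 :: "nat \<Rightarrow> ('a \<Rightarrow> real) \<Rightarrow> real" where
  "level_norm2 j w = (if j = 0 then energy \<Omega> w w
     else (L2_norm \<Omega> (\<lambda>x. inverse (mesh_size (\<T> j) x) * w x))\<^sup>2)"

abbreviation error :: "'a \<Rightarrow> real" where
  "error \<equiv> \<lambda>x. u x - v x"

abbreviation fe :: "nat \<Rightarrow> real Matrix.vec \<Rightarrow> 'a \<Rightarrow> real" where
  "fe j \<equiv> fe_function \<Omega> (\<T> j) (p j)"

abbreviation ndof :: "nat \<Rightarrow> nat" where
  "ndof j \<equiv> card (free_nodes \<Omega> (\<T> j))"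

lemma level_mesh: "enumerated_fe_mesh \<Omega> (\<T> j) (p j)"
  using hierarchy nodes by unfold_locales (auto simp: mesh_hierarchy_def)

lemma level_fe_mesh: "fe_mesh \<Omega> (\<T> j)"
  using level_mesh by (rule enumerated_fe_mesh.axioms(1))

lemma nested: "j \<le> k \<Longrightarrow> fe_space \<Omega> (\<T> j) \<subseteq> fe_space \<Omega> (\<T> k)"
proof (induction k rule: dec_induct)
  case (step k)
  have "dyadic_refinement (\<T> k) (\<T> (Suc k))" using hierarchy by (simp add: mesh_hierarchy_def)
  then have "fe_space \<Omega> (\<T> k) \<subseteq> fe_space \<Omega> (\<T> (Suc k))"
    by (intro fe_space_mono) (simp add: dyadic_refinement_def)
  then show ?case using step.IH by (rule subset_trans[rotated])
qed simp

lemma error_in_space: "error \<in> fe_space \<Omega> (\<T> J)"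
  using u v by (intro fe_space_diff) (auto simp: galerkin_solution_def)

lemma spd_level_matrix: "spd_matrix (ndof j) (level_matrix j)"
  using enumerated_fe_mesh.spd_stiffness[OF level_mesh] enumerated_fe_mesh.spd_diagonal[OF level_mesh]
  by (simp add: level_matrix_def)

lemma level_residual_carrier: "level_residual j \<in> carrier_vec (ndof j)"
  unfolding level_residual_def by (rule enumerated_fe_mesh.residual_vector_carrier[OF level_mesh])

lemma scalar_prod_level_residual:
  assumes "j \<le> J"
  shows "Matrix.scalar_prod c (level_residual j) = energy \<Omega> (fe j c) error"
  unfolding level_residual_def
  by (rule enumerated_fe_mesh.scalar_prod_residual_vector[OF level_mesh level_fe_mesh nested[OF assms] f v u])

lemma level_matrix_equiv:
  assumes basis: "stable_basis c\<^sub>B C\<^sub>B \<Omega> \<T>" and c: "c \<in> carrier_vec (ndof j)"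
  shows "min 1 c\<^sub>B * level_norm2 j (fe j c) \<le> quad_form (level_matrix j) c"
    and "quad_form (level_matrix j) c \<le> max 1 C\<^sub>B * level_norm2 j (fe j c)"
proof -
  have nonneg: "0 \<le> level_norm2 j (fe j c)" by (simp add: level_norm2_def energy_nonneg)
  have "min 1 c\<^sub>B * level_norm2 j (fe j c) \<le> (if j = 0 then 1 else c\<^sub>B) * level_norm2 j (fe j c)"
    using nonneg by (intro mult_right_mono) auto
  also have "\<dots> \<le> quad_form (level_matrix j) c"
    using enumerated_fe_mesh.quad_form_stiffness[OF level_mesh, of c 0] c
      enumerated_fe_mesh.quad_form_diagonal_stable(1)[OF level_mesh basis refl c]
    by (auto simp: level_matrix_def level_norm2_def)
  finally show "min 1 c\<^sub>B * level_norm2 j (fe j c) \<le> quad_form (level_matrix j) c" .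
  have "quad_form (level_matrix j) c \<le> (if j = 0 then 1 else C\<^sub>B) * level_norm2 j (fe j c)"
    using enumerated_fe_mesh.quad_form_stiffness[OF level_mesh, of c 0] c
      enumerated_fe_mesh.quad_form_diagonal_stable(2)[OF level_mesh basis refl c]
    by (auto simp: level_matrix_def level_norm2_def)
  also have "\<dots> \<le> max 1 C\<^sub>B * level_norm2 j (fe j c)"
    using nonneg by (intro mult_right_mono) auto
  finally show "quad_form (level_matrix j) c \<le> max 1 C\<^sub>B * level_norm2 j (fe j c)" .
qed

definition splittings :: "('a \<Rightarrow> real) \<Rightarrow> (nat \<Rightarrow> 'a \<Rightarrow> real) set" where
  "splittings w = {ws. (\<forall>j\<le>J. ws j \<in> fe_space \<Omega> (\<T> j)) \<and> w = (\<lambda>x. \<Sum>j\<le>J. ws j x)}"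

lemma sum_atMost_split: "(\<Sum>j\<le>J. F j) = F 0 + (\<Sum>j=1..J. F j)" for F :: "nat \<Rightarrow> real"
  by (simp add: atMost_atLeast0 sum.atLeast_Suc_atMost)

text \<open>The infimum over all splittings is used in two ways: a concrete splitting bounds it from above, and
  a common lower bound \<open>b\<close> of all splittings bounds it from below. The latter needs at least one
  splitting, namely the one that puts everything on the finest level.\<close>

lemma splitting_norm:
  assumes split: "stable_splitting c\<^sub>S C\<^sub>S \<Omega> \<T>" and w: "w \<in> fe_space \<Omega> (\<T> J)"
  shows "ws \<in> splittings w \<Longrightarrow> c\<^sub>S * energy \<Omega> w w \<le> (\<Sum>j\<le>J. level_norm2 j (ws j))"
    and "(\<And>ws. ws \<in> splittings w \<Longrightarrow> b \<le> (\<Sum>j\<le>J. level_norm2 j (ws j))) \<Longrightarrow> b \<le> C\<^sub>S * energy \<Omega> w w"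
proof -
  let ?F = "\<lambda>ws. \<Sum>j\<le>J. level_norm2 j (ws j)"
  have G: "(\<lambda>ws. (L2_norm \<Omega> (grad (ws 0)))\<^sup>2 +
      (\<Sum>j=1..J. (L2_norm \<Omega> (\<lambda>x. inverse (mesh_size (\<T> j) x) * ws j x))\<^sup>2)) = ?F"
    unfolding sum_atMost_split by (intro ext) (simp add: level_norm2_def energy_eq_L2_norm)
  have E: "c\<^sub>S * energy \<Omega> w w \<le> (INF ws\<in>splittings w. ?F ws)"
      "(INF ws\<in>splittings w. ?F ws) \<le> C\<^sub>S * energy \<Omega> w w"
    using split[unfolded stable_splitting_def Let_def, THEN conjunct2, THEN conjunct2, rule_format, OF w]
    unfolding splittings_def energy_eq_L2_norm[symmetric] G by blast+
  have "0 \<le> ?F ws" for ws by (intro sum_nonneg) (simp add: level_norm2_def energy_nonneg)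
  then have bdd: "bdd_below (?F ` splittings w)" by (intro bdd_belowI[of _ 0]) auto
  show "c\<^sub>S * energy \<Omega> w w \<le> ?F ws" if "ws \<in> splittings w"
    using E(1) cINF_lower[OF bdd that] by linarith
  have "(\<lambda>j. if j = J then w else (\<lambda>x. 0)) \<in> splittings w"
    unfolding splittings_def using w fe_space_0 by (auto simp: if_distrib[of "\<lambda>g. g _"] cong: if_cong)
  then have ne: "splittings w \<noteq> {}" by blast
  show "b \<le> C\<^sub>S * energy \<Omega> w w" if "\<And>ws. ws \<in> splittings w \<Longrightarrow> b \<le> ?F ws"
  proof -
    have "b \<le> (INF ws\<in>splittings w. ?F ws)" using ne that by (rule cINF_greatest)
    then show ?thesis using E(2) by linarith
  qed
qed

text \<open>Reliability. Write the error \<open>e\<close> as a sum of \<open>w\<^sub>j\<close> with coefficient vectors \<open>c\<^sub>j\<close>. Its energy is the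
  residual applied to \<open>e\<close>, hence the sum of the products of \<open>c\<^sub>j\<close> with the level residuals. Young's
  inequality on each level separates the estimator from the splitting functional, whose infimum is
  controlled by the energy of \<open>e\<close> itself.\<close>

lemma error_le_estimator:
  assumes split: "stable_splitting c\<^sub>S C\<^sub>S \<Omega> \<T>" and basis: "stable_basis c\<^sub>B C\<^sub>B \<Omega> \<T>"
  shows "energy \<Omega> error error \<le> C\<^sub>S * max 1 C\<^sub>B * estimator"
proof -
  let ?a = "energy \<Omega> error error"
  define k where "k = C\<^sub>S * max 1 C\<^sub>B"
  have "0 < C\<^sub>S" using split by (simp add: stable_splitting_def)
  then have k: "0 < k" by (simp add: k_def)
  \<comment> \<open>This Young parameter lets half of the left-hand side absorb the splitting functional.\<close>
  define s where "s = 1 / k"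
  have s: "0 < s" "s * k = 1" using k by (simp_all add: s_def)
  have "(2 * s * ?a - estimator) / (s\<^sup>2 * max 1 C\<^sub>B) \<le> C\<^sub>S * ?a"
  proof (rule splitting_norm(2)[OF split error_in_space])
    fix ws assume ws: "ws \<in> splittings error"
    define c where "c j = Matrix.vec (ndof j) (\<lambda>m. ws j (p j m))" for j
    have c: "c j \<in> carrier_vec (ndof j)" for j by (simp add: c_def)
    have fe_c: "fe j (c j) = ws j" if "j \<le> J" for j
      unfolding c_def using ws that
      by (intro enumerated_fe_mesh.fe_function_nodal_values[OF level_mesh]) (simp add: splittings_def)
    have wsJ: "ws j \<in> fe_space \<Omega> (\<T> J)" if "j \<le> J" for j
      using ws nested[OF that] that by (auto simp: splittings_def)
    have "?a = energy \<Omega> (\<lambda>x. \<Sum>j\<le>J. ws j x) error" using ws unfolding splittings_def by simp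
    also have "\<dots> = (\<Sum>j\<le>J. energy \<Omega> (ws j) error)"
      by (rule fe_mesh.energy_sum_left[OF level_fe_mesh _ error_in_space]) (simp add: wsJ)
    also have "\<dots> = (\<Sum>j\<le>J. Matrix.scalar_prod (c j) (level_residual j))"
      by (intro sum.cong refl) (simp add: scalar_prod_level_residual fe_c)
    finally have "2 * s * ?a = (\<Sum>j\<le>J. 2 * s * Matrix.scalar_prod (c j) (level_residual j))"
      by (simp add: sum_distrib_left)
    also have "\<dots> \<le> (\<Sum>j\<le>J. s\<^sup>2 * quad_form (level_matrix j) (c j)
        + quad_form (mat_inv (level_matrix j)) (level_residual j))"
      by (rule sum_mono) (rule young_spd[OF spd_level_matrix c level_residual_carrier])
    also have "\<dots> = s\<^sup>2 * (\<Sum>j\<le>J. quad_form (level_matrix j) (c j)) + estimator"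
      by (simp add: sum.distrib sum_distrib_left estimator_def)
    also have "\<dots> \<le> s\<^sup>2 * (\<Sum>j\<le>J. max 1 C\<^sub>B * level_norm2 j (ws j)) + estimator"
    proof (intro add_right_mono mult_left_mono sum_mono)
      fix j assume "j \<in> {..J}"
      then have "fe j (c j) = ws j" by (intro fe_c) simp
      then show "quad_form (level_matrix j) (c j) \<le> max 1 C\<^sub>B * level_norm2 j (ws j)"
        using level_matrix_equiv(2)[OF basis c, of j] by simp
    qed simp
    finally have "2 * s * ?a - estimator \<le> (\<Sum>j\<le>J. level_norm2 j (ws j)) * (s\<^sup>2 * max 1 C\<^sub>B)"
      by (simp add: sum_distrib_left[symmetric] algebra_simps)
    then show "(2 * s * ?a - estimator) / (s\<^sup>2 * max 1 C\<^sub>B) \<le> (\<Sum>j\<le>J. level_norm2 j (ws j))"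
      using s(1) by (simp add: pos_divide_le_eq)
  qed
  then have "2 * s * ?a - estimator \<le> C\<^sub>S * ?a * (s\<^sup>2 * max 1 C\<^sub>B)"
    using s(1) by (simp add: pos_divide_le_eq)
  also have "\<dots> = s * (s * k) * ?a" by (simp add: k_def power2_eq_square)
  finally have "s * ?a \<le> estimator" using s(2) by simp
  then have "k * (s * ?a) \<le> k * estimator" using k by (intro mult_left_mono) auto
  moreover have "k * (s * ?a) = ?a" using k by (simp add: s_def)
  ultimately show ?thesis unfolding k_def by (simp only:)
qed

text \<open>Efficiency. Solving with the level matrices gives corrections whose sum \<open>w\<close> satisfies that the
  residual at \<open>w\<close> equals the estimator. The corrections form one particular splitting of \<open>w\<close>, so the
  energy of \<open>w\<close> is bounded by the estimator as well, and nonnegativity of the energy of \<open>e - t w\<close>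
  compares the estimator with the energy of \<open>e\<close>. The meshes being nested puts \<open>w\<close> into the finest
  space.\<close>

lemma estimator_le_error:
  assumes split: "stable_splitting c\<^sub>S C\<^sub>S \<Omega> \<T>" and basis: "stable_basis c\<^sub>B C\<^sub>B \<Omega> \<T>"
  shows "c\<^sub>S * min 1 c\<^sub>B * estimator \<le> energy \<Omega> error error"
proof -
  have pos: "0 < c\<^sub>S" "0 < c\<^sub>B" using split basis by (simp_all add: stable_splitting_def stable_basis_def)
  define t where "t = c\<^sub>S * min 1 c\<^sub>B"
  have t: "0 < t" using pos by (simp add: t_def)
  define y where "y j = mat_inv (level_matrix j) *\<^sub>v level_residual j" for j
  note sol = mat_inv_solves[OF spd_level_matrix level_residual_carrier, folded y_def]
  define w where "w = (\<lambda>x. \<Sum>j\<le>J. fe j (y j) x)"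
  have fej: "fe j (y j) \<in> fe_space \<Omega> (\<T> j)" for j
    by (rule enumerated_fe_mesh.fe_function_in_space[OF level_mesh])
  have feJ: "fe j (y j) \<in> fe_space \<Omega> (\<T> J)" if "j \<in> {..J}" for j
    using fej nested that by blast
  have wJ: "w \<in> fe_space \<Omega> (\<T> J)" unfolding w_def by (rule fe_space_sum[OF feJ])
  have "energy \<Omega> w error = (\<Sum>j\<le>J. energy \<Omega> (fe j (y j)) error)"
    unfolding w_def by (rule fe_mesh.energy_sum_left[OF level_fe_mesh feJ error_in_space])
  also have "\<dots> = (\<Sum>j\<le>J. Matrix.scalar_prod (y j) (level_residual j))"
    by (intro sum.cong refl) (simp add: scalar_prod_level_residual)
  also have "\<dots> = (\<Sum>j\<le>J. quad_form (level_matrix j) (y j))"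
    using sol(2) by (simp add: quad_form_def)
  also have "\<dots> = estimator" using sol(3) by (simp add: estimator_def)
  finally have ew: "energy \<Omega> error w = estimator" by (simp add: energy_sym)
  have "(\<lambda>j. fe j (y j)) \<in> splittings w" using fej by (simp add: splittings_def w_def)
  then have "c\<^sub>S * energy \<Omega> w w \<le> (\<Sum>j\<le>J. level_norm2 j (fe j (y j)))"
    by (rule splitting_norm(1)[OF split wJ])
  then have "min 1 c\<^sub>B * (c\<^sub>S * energy \<Omega> w w) \<le> min 1 c\<^sub>B * (\<Sum>j\<le>J. level_norm2 j (fe j (y j)))"
    using pos by (intro mult_left_mono) auto
  also have "\<dots> = (\<Sum>j\<le>J. min 1 c\<^sub>B * level_norm2 j (fe j (y j)))" by (rule sum_distrib_left)
  also have "\<dots> \<le> (\<Sum>j\<le>J. quad_form (level_matrix j) (y j))"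
    by (intro sum_mono level_matrix_equiv(1)[OF basis] sol(1))
  also have "\<dots> = estimator" using sol(3) by (simp add: estimator_def)
  finally have ww: "t * energy \<Omega> w w \<le> estimator" by (simp add: t_def mult.commute mult.left_commute)
  have "0 \<le> energy \<Omega> (\<lambda>x. error x - t * w x) (\<lambda>x. error x - t * w x)" by (rule energy_nonneg)
  also have "\<dots> = energy \<Omega> error error - 2 * t * energy \<Omega> error w + t\<^sup>2 * energy \<Omega> w w"
    by (rule fe_mesh.energy_expand[OF level_fe_mesh error_in_space wJ])
  also have "\<dots> = energy \<Omega> error error - 2 * t * estimator + t * (t * energy \<Omega> w w)"
    by (simp add: ew power2_eq_square)
  also have "\<dots> \<le> energy \<Omega> error error - 2 * t * estimator + t * estimator"
    using ww t by (simp add: mult_left_mono)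
  finally show ?thesis by (simp add: t_def)
qed

end

section \<open>Estimating the coarsest level by conjugate gradients\<close>

theorem mainTheorem1:
  fixes \<Omega> :: "(real ^ 'n) set" and \<T> :: "nat \<Rightarrow> (real ^ 'n) set set"
    and C\<^sub>3\<^sub>D :: real
    and c\<^sub>S C\<^sub>S c\<^sub>B C\<^sub>B :: "nat \<Rightarrow> real \<Rightarrow> real"
    and f u v :: "real ^ 'n \<Rightarrow> real"
    and J i :: nat
    and p :: "nat \<Rightarrow> nat \<Rightarrow> real ^ 'n"
    and P :: "real Matrix.mat" and c :: "nat \<Rightarrow> real Matrix.vec"
    and \<zeta> :: real
  defines "d \<equiv> CARD('n)"
    and "\<gamma> \<equiv> shape_regularity (\<T> 0)"
    and "n\<^sub>0 \<equiv> card (free_nodes \<Omega> (\<T> 0))"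
    and "r \<equiv> \<lambda>j. residual_vector \<Omega> (\<T> j) (p j) f v"
    and "D \<equiv> \<lambda>j. stiffness_diagonal \<Omega> (\<T> j) (p j)"
    and "A\<^sub>0 \<equiv> stiffness_matrix \<Omega> (\<T> 0) (p 0)"
  defines "c\<^sub>0 \<equiv> mat_inv A\<^sub>0 *\<^sub>v r 0"
    and "\<mu>\<^sub>i \<equiv> sqrt (\<Sum>m<i. (energy_norm A\<^sub>0 (c (Suc m) - c m))\<^sup>2)"
    and "\<eta> \<equiv> \<Sum>j=1..J. quad_form (mat_inv (D j)) (r j)"
    and "cB_bar \<equiv> min 1 (c\<^sub>B d \<gamma>)"
    and "CB_bar \<equiv> max 1 (C\<^sub>B d \<gamma>)"
  assumes dim: "d = 2 \<or> d = 3"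
    and splitting: "\<forall>(\<Omega>' :: (real ^ 'n) set) \<T>'. mesh_hierarchy C\<^sub>3\<^sub>D \<Omega>' \<T>' \<longrightarrow>
          stable_splitting (c\<^sub>S d (shape_regularity (\<T>' 0))) (C\<^sub>S d (shape_regularity (\<T>' 0))) \<Omega>' \<T>'"
    and basis: "\<forall>(\<Omega>' :: (real ^ 'n) set) \<T>'. mesh_hierarchy C\<^sub>3\<^sub>D \<Omega>' \<T>' \<longrightarrow>
          stable_basis (c\<^sub>B d (shape_regularity (\<T>' 0))) (C\<^sub>B d (shape_regularity (\<T>' 0))) \<Omega>' \<T>'"
    and hierarchy: "mesh_hierarchy C\<^sub>3\<^sub>D \<Omega> \<T>"
    and nodes: "\<forall>j. enumerates (p j) (free_nodes \<Omega> (\<T> j))"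
    and f: "in_L2 \<Omega> f"
    and J: "1 \<le> J"
    and v: "v \<in> fe_space \<Omega> (\<T> J)"
    and u: "galerkin_solution \<Omega> (\<T> J) f u"
    and P: "spd_matrix n\<^sub>0 P"
    and pcg: "pcg_iterates n\<^sub>0 P A\<^sub>0 (r 0) c"
    and \<zeta>: "(energy_norm A\<^sub>0 (c\<^sub>0 - c i))\<^sup>2 \<le> \<zeta>\<^sup>2"
  shows "quad_form (mat_inv A\<^sub>0) (r 0) \<le> \<mu>\<^sub>i\<^sup>2 + \<zeta>\<^sup>2 \<and>
    L2_norm \<Omega> (grad (\<lambda>x. u x - v x))
      \<le> sqrt (C\<^sub>S d \<gamma>) * sqrt CB_bar * sqrt (\<eta> + \<mu>\<^sub>i\<^sup>2 + \<zeta>\<^sup>2) \<and>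
    (\<forall>\<theta>>0. \<zeta>\<^sup>2 \<le> \<theta> * (\<eta> + \<mu>\<^sub>i\<^sup>2) \<longrightarrow>
      sqrt (\<eta> + \<mu>\<^sub>i\<^sup>2 + \<zeta>\<^sup>2)
        \<le> sqrt (1 + \<theta>) * (1 / sqrt (c\<^sub>S d \<gamma>)) * (1 / sqrt cB_bar) *
           L2_norm \<Omega> (grad (\<lambda>x. u x - v x)))"
proof -
  interpret multilevel_residual C\<^sub>3\<^sub>D \<Omega> \<T> p J f u v
    using hierarchy nodes f v u by unfold_locales auto
  have split: "stable_splitting (c\<^sub>S d \<gamma>) (C\<^sub>S d \<gamma>) \<Omega> \<T>"
    and basis: "stable_basis (c\<^sub>B d \<gamma>) (C\<^sub>B d \<gamma>) \<Omega> \<T>"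
    using splitting basis hierarchy unfolding \<gamma>_def by blast+
  define E where "E = quad_form (mat_inv A\<^sub>0) (r 0)"
  have est: "estimator = \<eta> + E"
    unfolding estimator_def sum_atMost_split \<eta>_def E_def
    by (simp add: level_matrix_def level_residual_def A\<^sub>0_def D_def r_def)
  have A0: "spd_matrix n\<^sub>0 A\<^sub>0" using spd_level_matrix[of 0] by (simp add: level_matrix_def A\<^sub>0_def n\<^sub>0_def)
  have r0: "r 0 \<in> carrier_vec n\<^sub>0" using level_residual_carrier[of 0] by (simp add: level_residual_def r_def n\<^sub>0_def)
  have \<mu>: "\<mu>\<^sub>i\<^sup>2 = (\<Sum>m<i. (energy_norm A\<^sub>0 (c (Suc m) - c m))\<^sup>2)"
    unfolding \<mu>\<^sub>i_def by (rule real_sqrt_pow2) (simp add: sum_nonneg)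
  have E: "E = \<mu>\<^sub>i\<^sup>2 + (energy_norm A\<^sub>0 (c\<^sub>0 - c i))\<^sup>2"
    unfolding E_def \<mu> c\<^sub>0_def by (rule pcg_energy_identity[OF A0 P r0 pcg])
  have E_le: "E \<le> \<mu>\<^sub>i\<^sup>2 + \<zeta>\<^sup>2" and \<mu>_le: "\<mu>\<^sub>i\<^sup>2 \<le> E" using E \<zeta> by simp_all
  have pos: "0 < c\<^sub>S d \<gamma>" "0 < C\<^sub>S d \<gamma>" "0 < cB_bar" "0 < CB_bar"
    using split basis by (simp_all add: stable_splitting_def stable_basis_def cB_bar_def CB_bar_def)
  let ?e = "L2_norm \<Omega> (grad (\<lambda>x. u x - v x))"
  have e: "?e = sqrt (energy \<Omega> (\<lambda>x. u x - v x) (\<lambda>x. u x - v x))"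
    by (simp add: L2_norm_def energy_def power2_norm_eq_inner)
  have "energy \<Omega> (\<lambda>x. u x - v x) (\<lambda>x. u x - v x) \<le> C\<^sub>S d \<gamma> * CB_bar * (\<eta> + E)"
    using error_le_estimator[OF split basis] est by (simp add: CB_bar_def)
  also have "\<dots> \<le> C\<^sub>S d \<gamma> * CB_bar * (\<eta> + \<mu>\<^sub>i\<^sup>2 + \<zeta>\<^sup>2)"
    using pos E_le by (intro mult_left_mono) auto
  finally have upper: "?e \<le> sqrt (C\<^sub>S d \<gamma>) * sqrt CB_bar * sqrt (\<eta> + \<mu>\<^sub>i\<^sup>2 + \<zeta>\<^sup>2)"
    unfolding e real_sqrt_mult[symmetric] by (rule real_sqrt_le_mono)
  have lower: "sqrt (\<eta> + \<mu>\<^sub>i\<^sup>2 + \<zeta>\<^sup>2)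
      \<le> sqrt (1 + \<theta>) * (1 / sqrt (c\<^sub>S d \<gamma>)) * (1 / sqrt cB_bar) * ?e"
    if \<theta>: "\<theta> > 0" "\<zeta>\<^sup>2 \<le> \<theta> * (\<eta> + \<mu>\<^sub>i\<^sup>2)" for \<theta>
  proof -
    have "\<eta> + \<mu>\<^sub>i\<^sup>2 + \<zeta>\<^sup>2 \<le> (1 + \<theta>) * (\<eta> + \<mu>\<^sub>i\<^sup>2)" using \<theta> by (simp add: algebra_simps)
    also have "\<dots> \<le> (1 + \<theta>) * (\<eta> + E)" using \<theta> \<mu>_le by (intro mult_left_mono) auto
    finally have le: "\<eta> + \<mu>\<^sub>i\<^sup>2 + \<zeta>\<^sup>2 \<le> (1 + \<theta>) * (\<eta> + E)" .
    have "\<eta> + E \<le> energy \<Omega> (\<lambda>x. u x - v x) (\<lambda>x. u x - v x) / (c\<^sub>S d \<gamma> * cB_bar)"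
      using estimator_le_error[OF split basis] est pos
      by (simp add: pos_le_divide_eq cB_bar_def mult.commute)
    then have "(1 + \<theta>) * (\<eta> + E) \<le> (1 + \<theta>) * (energy \<Omega> (\<lambda>x. u x - v x) (\<lambda>x. u x - v x) / (c\<^sub>S d \<gamma> * cB_bar))"
      using \<theta> by (intro mult_left_mono) auto
    with le have "\<eta> + \<mu>\<^sub>i\<^sup>2 + \<zeta>\<^sup>2 \<le> (1 + \<theta>) * (1 / c\<^sub>S d \<gamma>) * (1 / cB_bar) *
        energy \<Omega> (\<lambda>x. u x - v x) (\<lambda>x. u x - v x)" by simp
    then have "sqrt (\<eta> + \<mu>\<^sub>i\<^sup>2 + \<zeta>\<^sup>2) \<le> sqrt ((1 + \<theta>) * (1 / c\<^sub>S d \<gamma>) * (1 / cB_bar) *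
        energy \<Omega> (\<lambda>x. u x - v x) (\<lambda>x. u x - v x))" by (rule real_sqrt_le_mono)
    then show ?thesis by (simp add: e real_sqrt_mult real_sqrt_divide)
  qed
  show ?thesis using E_le upper lower unfolding E_def by blast
qed

end
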